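(* Let $\Sigma$ be a two-dimensional manifold embedded in a Riemannian manifold $(M,\bar g)$ of dimension $m=2+p$, let $\rho$ be a non-vanishing density on $\Sigma$, and let $N_1,\dots,N_p$ be an orthonormal frame of normal vectors of $\Sigma$. Let $K$ denote the Gaussian curvature and $H$ the mean curvature vector of $\Sigma$. Then $$K = \frac{1}{g}\,\bar g\big(\bar R(e_1,e_2)e_2,e_1\big) - \frac{\rho^2}{2g}\sum_{A=1}^p \operatorname{Tr}\mathcal{S}_A^2,$$ $$H = \frac{\rho^2}{2g}\sum_{A=1}^p \big(\operatorname{Tr}\mathcal{B}_A\big)N_A .$$
   Context: Setting: $x^1,\dots,x^m$ are local coordinates on $M$, $u^1,u^2$ local coordinates on $\Sigma$, and the embedding is given by functions $x^i(u^1,u^2)$. Indices $i,j,k,l$ run over $1,\dots,m$; $a,b,c$ over $1,2$; $A,B$ over $1,\dots,p$; repeated indices $i,j,\dots$ and $a,b,\dots$ are summed. $\bar\nabla$, $\bar\Gamma^i_{jk}$, $\bar R$ are the Levi-Civita connection, Christoffel symbols and curvature of $M$, with the convention that the sectional curvature of the plane spanned by $X,Y$ is $\bar g(\bar R(X,Y)Y,X)/(\bar g(X,X)\bar g(Y,Y)-\bar g(X,Y)^2)$. $T\Sigma\subset TM$ has basis $e_a=(\partial_a x^i)\partial_i$; $g_{ab}=\bar g(e_a,e_b)$ is the induced metric, $g=\det(g_{ab})$, $g^{ab}$ its inverse. The normal vectors $N_A=n_A^i\partial_i$ satisfy $\bar g(N_A,N_B)=\delta_{AB}$, $\bar g(N_A,e_a)=0$;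 $\bar\nabla_a=\bar\nabla_{e_a}$. The second fundamental forms are $h_{A,ab}=-\bar g(e_a,\bar\nabla_b N_A)$ and the Weingarten maps are $(W_A)^a_b=g^{ac}h_{A,cb}$. The mean curvature vector is $H=\frac12\sum_{A}(\operatorname{tr}W_A)N_A$. Poisson bracket: $\rho$ is a non-vanishing density on $\Sigma$ (under coordinate change $\tilde\rho(v)=|\partial(u^1,u^2)/\partial(v^1,v^2)|\,\rho(u(v))$) and $\{f,h\}=\frac1\rho\varepsilon^{ab}(\partial_a f)(\partial_b h)$ with $\varepsilon^{ab}$ antisymmetric, $\varepsilon^{12}=1$. Maps: $\mathcal{P}^{ij}=\{x^i,x^j\}$ and $\mathcal{S}_A^{ij}=\frac1\rho\varepsilon^{ab}(\partial_a x^i)(\bar\nabla_b N_A)^j=\{x^i,n_A^j\}+\{x^i,x^k\}\bar\Gamma^j_{kl}n_A^l$. They define linear maps $TM\to TM$ (at points of $\Sigma$) by $\mathcal{P}(X)=\mathcal{P}^{ik}\bar g_{kj}X^j\partial_i$ and $\mathcal{S}_A(X)=\mathcal{S}_A^{ik}\bar g_{kj}X^j\partial_i$, and $\mathcal{B}_A=\mathcal{P}\mathcal{S}_A$ (composition). $\operatorname{Tr}$ denotes the trace of a map $TM\to TM$. *)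

theory Defs
  imports "HOL-Analysis.Analysis"
begin

section \<open>Smooth functions\<close>

text \<open>Intended for open \<open>S\<close>; only the values of \<open>f\<close> on \<open>S\<close> matter then.\<close>

primrec Ck_on ::
  "nat \<Rightarrow> 'a::real_normed_vector set \<Rightarrow> ('a \<Rightarrow> 'b::real_normed_vector) \<Rightarrow> bool" where
  "Ck_on 0 S f \<longleftrightarrow> continuous_on S f"
| "Ck_on (Suc k) S f \<longleftrightarrow> (\<forall>x\<in>S. f differentiable (at x)) \<and>
     (\<forall>v. Ck_on k S (\<lambda>x. frechet_derivative f (at x) v))"

definition smooth_on ::
  "'a::real_normed_vector set \<Rightarrow> ('a \<Rightarrow> 'b::real_normed_vector) \<Rightarrow> bool" where
  "smooth_on S f \<longleftrightarrow> (\<forall>k. Ck_on k S f)"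

definition pd :: "'n::finite \<Rightarrow> (real^'n \<Rightarrow> 'b::real_normed_vector) \<Rightarrow> real^'n \<Rightarrow> 'b" where
  "pd a f u = frechet_derivative f (at u) (axis a 1)"


section \<open>Metrics, Levi-Civita connection and curvature in coordinates\<close>

text \<open>A metric is given by its component matrix \<open>g x $ i $ j\<close> as a function of the coordinates.\<close>

definition mform :: "real^'n^'n \<Rightarrow> real^'n \<Rightarrow> real^'n \<Rightarrow> real" where
  "mform Q X Y = (\<Sum>i\<in>UNIV. \<Sum>j\<in>UNIV. Q $ i $ j * X $ i * Y $ j)"

text \<open>\<open>christoffel g i j k\<close> is $\Gamma^i_{jk}$.\<close>

definition christoffel ::
  "(real^'n::finite \<Rightarrow> real^'n^'n) \<Rightarrow> 'n \<Rightarrow> 'n \<Rightarrow> 'n \<Rightarrow> real^'n \<Rightarrow> real" where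
  "christoffel g i j k x = (1/2) * (\<Sum>l\<in>UNIV. matrix_inv (g x) $ i $ l *
     (pd j (\<lambda>y. g y $ k $ l) x + pd k (\<lambda>y. g y $ j $ l) x - pd l (\<lambda>y. g y $ j $ k) x))"

text \<open>\<open>riemann g i j k l\<close> is the \<open>i\<close>-th component of
  $R(\partial_k,\partial_l)\partial_j = \nabla_k\nabla_l\partial_j - \nabla_l\nabla_k\partial_j$.\<close>

definition riemann ::
  "(real^'n::finite \<Rightarrow> real^'n^'n) \<Rightarrow> 'n \<Rightarrow> 'n \<Rightarrow> 'n \<Rightarrow> 'n \<Rightarrow> real^'n \<Rightarrow> real" where
  "riemann g i j k l x =
     pd k (christoffel g i l j) x - pd l (christoffel g i k j) x
     + (\<Sum>q\<in>UNIV. christoffel g i k q x * christoffel g q l j x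
               - christoffel g i l q x * christoffel g q k j x)"

text \<open>\<open>curvature g x X Y Z\<close> is $R(X,Y)Z$ at the point \<open>x\<close>.\<close>

definition curvature ::
  "(real^'n::finite \<Rightarrow> real^'n^'n) \<Rightarrow> real^'n \<Rightarrow> real^'n \<Rightarrow> real^'n \<Rightarrow> real^'n \<Rightarrow> real^'n" where
  "curvature g x X Y Z = (\<chi> i. \<Sum>j\<in>UNIV. \<Sum>k\<in>UNIV. \<Sum>l\<in>UNIV.
     riemann g i j k l x * X $ k * Y $ l * Z $ j)"

definition sectional_curvature ::
  "(real^'n::finite \<Rightarrow> real^'n^'n) \<Rightarrow> real^'n \<Rightarrow> real^'n \<Rightarrow> real^'n \<Rightarrow> real" where
  "sectional_curvature g x X Y = mform (g x) (curvature g x X Y Y) X /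
     (mform (g x) X X * mform (g x) Y Y - (mform (g x) X Y)\<^sup>2)"

definition gaussian_curvature :: "(real^2 \<Rightarrow> real^2^2) \<Rightarrow> real^2 \<Rightarrow> real" where
  "gaussian_curvature g u = sectional_curvature g u (axis 1 1) (axis 2 1)"


section \<open>Parametrised surfaces\<close>

text \<open>In this section \<open>x\<close> is the embedding in coordinates, \<open>G\<close> the metric of the ambient
  space, and \<open>n\<close> the components of a vector field along the surface, as a function of the
  coordinates of the surface.\<close>

definition induced_metric ::
  "(real^'m::finite \<Rightarrow> real^'m^'m) \<Rightarrow> (real^2 \<Rightarrow> real^'m) \<Rightarrow> real^2 \<Rightarrow> real^2^2" where
  "induced_metric G x u = (\<chi> a b. mform (G (x u)) (pd a x u) (pd b x u))"

definition cov_along ::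
  "(real^'m::finite \<Rightarrow> real^'m^'m) \<Rightarrow> (real^2 \<Rightarrow> real^'m) \<Rightarrow> (real^2 \<Rightarrow> real^'m) \<Rightarrow>
   2 \<Rightarrow> real^2 \<Rightarrow> real^'m" where
  "cov_along G x n b u = pd b n u +
     (\<chi> j. \<Sum>k\<in>UNIV. \<Sum>l\<in>UNIV. christoffel G j k l (x u) * pd b x u $ k * n u $ l)"

definition second_ff ::
  "(real^'m::finite \<Rightarrow> real^'m^'m) \<Rightarrow> (real^2 \<Rightarrow> real^'m) \<Rightarrow> (real^2 \<Rightarrow> real^'m) \<Rightarrow>
   real^2 \<Rightarrow> real^2^2" where
  "second_ff G x n u = (\<chi> a b. - mform (G (x u)) (pd a x u) (cov_along G x n b u))"

definition weingarten ::
  "(real^'m::finite \<Rightarrow> real^'m^'m) \<Rightarrow> (real^2 \<Rightarrow> real^'m) \<Rightarrow> (real^2 \<Rightarrow> real^'m) \<Rightarrow>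
   real^2 \<Rightarrow> real^2^2" where
  "weingarten G x n u = matrix_inv (induced_metric G x u) ** second_ff G x n u"

definition mean_curvature_vector ::
  "(real^'m::finite \<Rightarrow> real^'m^'m) \<Rightarrow> (real^2 \<Rightarrow> real^'m) \<Rightarrow> nat \<Rightarrow>
   (nat \<Rightarrow> real^2 \<Rightarrow> real^'m) \<Rightarrow> real^2 \<Rightarrow> real^'m" where
  "mean_curvature_vector G x p n u =
     (1/2) *\<^sub>R (\<Sum>A=1..p. trace (weingarten G x (n A) u) *\<^sub>R n A u)"

definition eps :: "2 \<Rightarrow> 2 \<Rightarrow> real" where
  "eps a b = (if a = 1 \<and> b = 2 then 1 else if a = 2 \<and> b = 1 then - 1 else 0)"

definition poisson ::
  "(real^2 \<Rightarrow> real) \<Rightarrow> (real^2 \<Rightarrow> real) \<Rightarrow> (real^2 \<Rightarrow> real) \<Rightarrow> real^2 \<Rightarrow> real" where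
  "poisson r f h u = (1 / r u) * (\<Sum>a\<in>UNIV. \<Sum>b\<in>UNIV. eps a b * pd a f u * pd b h u)"

definition P_comp ::
  "(real^2 \<Rightarrow> real) \<Rightarrow> (real^2 \<Rightarrow> real^'m::finite) \<Rightarrow> real^2 \<Rightarrow> real^'m^'m" where
  "P_comp r x u = (\<chi> i j. poisson r (\<lambda>v. x v $ i) (\<lambda>v. x v $ j) u)"

definition S_comp ::
  "(real^'m::finite \<Rightarrow> real^'m^'m) \<Rightarrow> (real^2 \<Rightarrow> real) \<Rightarrow> (real^2 \<Rightarrow> real^'m) \<Rightarrow>
   (real^2 \<Rightarrow> real^'m) \<Rightarrow> real^2 \<Rightarrow> real^'m^'m" where
  "S_comp G r x n u = (\<chi> i j. (1 / r u) *
     (\<Sum>a\<in>UNIV. \<Sum>b\<in>UNIV. eps a b * pd a x u $ i * cov_along G x n b u $ j))"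

text \<open>The endomorphism $X \mapsto T^{ik} Q_{kj} X^j \partial_i$.\<close>

definition lower_map :: "real^'m^'m \<Rightarrow> real^'m^'m \<Rightarrow> real^'m \<Rightarrow> real^'m" where
  "lower_map Q T X = (\<chi> i. \<Sum>k\<in>UNIV. \<Sum>j\<in>UNIV. T $ i $ k * Q $ k $ j * X $ j)"

definition P_map ::
  "(real^'m::finite \<Rightarrow> real^'m^'m) \<Rightarrow> (real^2 \<Rightarrow> real) \<Rightarrow> (real^2 \<Rightarrow> real^'m) \<Rightarrow>
   real^2 \<Rightarrow> real^'m \<Rightarrow> real^'m" where
  "P_map G r x u = lower_map (G (x u)) (P_comp r x u)"

definition S_map ::
  "(real^'m::finite \<Rightarrow> real^'m^'m) \<Rightarrow> (real^2 \<Rightarrow> real) \<Rightarrow> (real^2 \<Rightarrow> real^'m) \<Rightarrow>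
   (real^2 \<Rightarrow> real^'m) \<Rightarrow> real^2 \<Rightarrow> real^'m \<Rightarrow> real^'m" where
  "S_map G r x n u = lower_map (G (x u)) (S_comp G r x n u)"

definition B_map ::
  "(real^'m::finite \<Rightarrow> real^'m^'m) \<Rightarrow> (real^2 \<Rightarrow> real) \<Rightarrow> (real^2 \<Rightarrow> real^'m) \<Rightarrow>
   (real^2 \<Rightarrow> real^'m) \<Rightarrow> real^2 \<Rightarrow> real^'m \<Rightarrow> real^'m" where
  "B_map G r x n u = P_map G r x u \<circ> S_map G r x n u"

definition Tr :: "(real^'m \<Rightarrow> real^'m) \<Rightarrow> real" where
  "Tr f = trace (matrix f)"


section \<open>Manifolds and fields on them\<close>

text \<open>A chart is a pair of its domain and its coordinate map. A manifold is given by a smooth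
  atlas; its underlying space is the union of the chart domains, and its dimension is
  \<open>CARD('n)\<close>.\<close>

type_synonym ('a, 'n) chart = "'a set \<times> ('a \<Rightarrow> real^'n)"

definition valid_chart :: "('a::topological_space, 'n::finite) chart \<Rightarrow> bool" where
  "valid_chart c \<longleftrightarrow> open (fst c) \<and> open (snd c ` fst c) \<and>
     (\<exists>f. homeomorphism (fst c) (snd c ` fst c) (snd c) f)"

definition chart_inv :: "('a, 'n::finite) chart \<Rightarrow> real^'n \<Rightarrow> 'a" where
  "chart_inv c = inv_into (fst c) (snd c)"

definition transition :: "('a, 'n::finite) chart \<Rightarrow> ('a, 'n) chart \<Rightarrow> real^'n \<Rightarrow> real^'n" where
  "transition c d = snd d \<circ> chart_inv c"

definition smooth_atlas ::
  "('a::{t2_space,second_countable_topology}, 'n::finite) chart set \<Rightarrow> bool" where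
  "smooth_atlas C \<longleftrightarrow> (\<forall>c\<in>C. valid_chart c) \<and>
     (\<forall>c\<in>C. \<forall>d\<in>C. smooth_on (snd c ` (fst c \<inter> fst d)) (transition c d))"

definition carrier :: "('a, 'n) chart set \<Rightarrow> 'a set" where
  "carrier C = (\<Union>c\<in>C. fst c)"

text \<open>Fields are families of coordinate components, one for each chart, subject to the
  transformation law of the respective type.\<close>

definition riemannian_manifold ::
  "('a::{t2_space,second_countable_topology}, 'n::finite) chart set \<Rightarrow>
   (('a, 'n) chart \<Rightarrow> real^'n \<Rightarrow> real^'n^'n) \<Rightarrow> bool" where
  "riemannian_manifold C G \<longleftrightarrow> smooth_atlas C \<and>
     (\<forall>c\<in>C. smooth_on (snd c ` fst c) (G c) \<and>
        (\<forall>y\<in>snd c ` fst c. transpose (G c y) = G c y \<and>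
           (\<forall>X. X \<noteq> 0 \<longrightarrow> mform (G c y) X X > 0))) \<and>
     (\<forall>c\<in>C. \<forall>d\<in>C. \<forall>q\<in>fst c \<inter> fst d.
        let J = jacobian (transition c d) (at (snd c q))
        in G c (snd c q) = transpose J ** G d (snd d q) ** J)"

definition nonvanishing_density ::
  "('s, 'n::finite) chart set \<Rightarrow> (('s, 'n) chart \<Rightarrow> real^'n \<Rightarrow> real) \<Rightarrow> bool" where
  "nonvanishing_density C \<rho> \<longleftrightarrow>
     (\<forall>c\<in>C. \<forall>v\<in>snd c ` fst c. \<rho> c v \<noteq> 0) \<and>
     (\<forall>c\<in>C. \<forall>d\<in>C. \<forall>s\<in>fst c \<inter> fst d.
        \<rho> c (snd c s) = \<bar>det (jacobian (transition c d) (at (snd c s)))\<bar> * \<rho> d (snd d s))"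

definition coord_rep ::
  "('s \<Rightarrow> 'a) \<Rightarrow> ('s, 'n::finite) chart \<Rightarrow> ('a, 'm::finite) chart \<Rightarrow> real^'n \<Rightarrow> real^'m" where
  "coord_rep F c d = snd d \<circ> F \<circ> chart_inv c"

definition smooth_embedding ::
  "('s::topological_space, 'n::finite) chart set \<Rightarrow> ('a::topological_space, 'm::finite) chart set \<Rightarrow>
   ('s \<Rightarrow> 'a) \<Rightarrow> bool" where
  "smooth_embedding C D F \<longleftrightarrow> F ` carrier C \<subseteq> carrier D \<and>
     (\<exists>F'. homeomorphism (carrier C) (F ` carrier C) F F') \<and>
     (\<forall>c\<in>C. \<forall>d\<in>D.
        smooth_on (snd c ` (fst c \<inter> F -` fst d)) (coord_rep F c d) \<and>
        (\<forall>s\<in>fst c \<inter> F -` fst d. inj (frechet_derivative (coord_rep F c d) (at (snd c s)))))"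

text \<open>A smooth orthonormal frame \<open>N 1, \<dots>, N p\<close> of normal fields over the open subset \<open>W\<close> of the
  surface (it need not exist over the whole surface). \<open>N A d s\<close> are the components, in the
  chart \<open>d\<close> of the ambient manifold, of a vector at \<open>F s\<close>.\<close>

definition normal_frame ::
  "('s::topological_space, 2) chart set \<Rightarrow> ('a::topological_space, 'm::finite) chart set \<Rightarrow>
   (('a, 'm) chart \<Rightarrow> real^'m \<Rightarrow> real^'m^'m) \<Rightarrow> ('s \<Rightarrow> 'a) \<Rightarrow> 's set \<Rightarrow> nat \<Rightarrow>
   (nat \<Rightarrow> ('a, 'm) chart \<Rightarrow> 's \<Rightarrow> real^'m) \<Rightarrow> bool" where
  "normal_frame C D G F W p N \<longleftrightarrow> open W \<and> W \<subseteq> carrier C \<and>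
     (\<forall>A\<in>{1..p}. \<forall>d\<in>D. \<forall>d'\<in>D. \<forall>s\<in>W \<inter> F -` (fst d \<inter> fst d').
        N A d' s = jacobian (transition d d') (at (snd d (F s))) *v N A d s) \<and>
     (\<forall>A\<in>{1..p}. \<forall>c\<in>C. \<forall>d\<in>D.
        smooth_on (snd c ` (fst c \<inter> W \<inter> F -` fst d)) (N A d \<circ> chart_inv c)) \<and>
     (\<forall>A\<in>{1..p}. \<forall>B\<in>{1..p}. \<forall>d\<in>D. \<forall>s\<in>W \<inter> F -` fst d.
        mform (G d (snd d (F s))) (N A d s) (N B d s) = (if A = B then 1 else 0)) \<and>
     (\<forall>A\<in>{1..p}. \<forall>c\<in>C. \<forall>d\<in>D. \<forall>s\<in>fst c \<inter> W \<inter> F -` fst d. \<forall>a.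
        mform (G d (snd d (F s))) (N A d s) (pd a (coord_rep F c d) (snd c s)) = 0)"

end

(* The Gauss equation: with D the covariant derivative along the surface,
   <R(e1,e2)e2,e1> = d1 <D2 e2,e1> - d2 <D1 e2,e1> - <D2 e2,D1 e1> + <D1 e2,D1 e2>.
   The numbers <Da eb,ec> are the Christoffel symbols of the first kind of the induced metric g.
   Expanding the last two products in the frame e1, e2, N_A therefore leaves a quantity that
   depends on g only, minus the sum of the det h_A. For the surface itself, with metric g and
   parametrised by the identity, the same identity has no normal part, so comparing the two
   gives det(g) K = <R(e1,e2)e2,e1> + sum det h_A. Finally S_A and P are of rank at most two, so
   the traces of S_A^2 and B_A are computed directly: they are -2 det(h_A) / rho^2 and
   det(g) tr(W_A) / rho^2. *)

theory Submission
  imports Defs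
begin

section \<open>Partial derivatives\<close>

text \<open>\<open>gaussian_curvature\<close> is built from the coordinate Riemann tensor of the
  induced metric, hence from derivatives of Christoffel symbols that contain the inverse of that
  metric. Relating these to the ambient symbols directly would mean computing the derivative of the
  inverse. The comparison with the intrinsic copy avoids it: the surface with its own metric and the
  identity parametrisation is again a surface of the same kind, with \<open>p = 0\<close>, so one
  lemma serves both sides. The price is that whatever is assumed of an ambient metric must be
  provable for the induced one. The locales therefore ask for differentiability of finite order at
  each point instead of \<open>smooth_on\<close>, and mixed partials are shown to commute from
  differentiability of the first partials at the point, with no continuity of the second ones.
  Identities are kept multiplied by the determinant of the induced metric, so that the tangential
  part of a product stays polynomial in its entries.\<close>

lemma pd_has_derivative: "(f has_derivative f') (at u) \<Longrightarrow> pd a f u = f' (axis a 1)"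
  unfolding pd_def using frechet_derivative_at by metis

lemma has_derivative_cong_open:
  assumes "open S" "u \<in> S" "\<And>v. v \<in> S \<Longrightarrow> f v = g v"
  shows "(f has_derivative D) (at u) \<longleftrightarrow> (g has_derivative D) (at u)"
  using assms has_derivative_transform_within_open[OF _ assms(1,2)] by metis

lemma differentiable_cong_open:
  assumes "open S" "u \<in> S" "\<And>v. v \<in> S \<Longrightarrow> f v = g v"
  shows "f differentiable (at u) \<longleftrightarrow> g differentiable (at u)"
  using has_derivative_cong_open[OF assms] by (simp add: differentiable_def)

text \<open>Both Frechet derivatives are chosen by the same predicate, so no differentiability is
  required.\<close>

lemma pd_cong_open:
  assumes "open S" "u \<in> S" "\<And>v. v \<in> S \<Longrightarrow> f v = g v"
  shows "pd a f u = pd a g u"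
  using has_derivative_cong_open[OF assms] by (simp add: pd_def frechet_derivative_def)

lemma pd_const [simp]: "pd a (\<lambda>v. c) u = 0"
  by (simp add: pd_def)

lemma pd_ident [simp]: "pd a (\<lambda>v. v) u = axis a 1"
  by (simp add: pd_def)

lemma pd_add:
  assumes "f differentiable (at u)" "h differentiable (at u)"
  shows "pd a (\<lambda>v. f v + h v) u = pd a f u + pd a h u"
proof -
  have "((\<lambda>v. f v + h v) has_derivative
      (\<lambda>y. frechet_derivative f (at u) y + frechet_derivative h (at u) y)) (at u)"
    using assms by (auto simp: frechet_derivative_works intro!: derivative_intros)
  from pd_has_derivative[OF this] show ?thesis by (simp add: pd_def)
qed

lemma pd_sum:
  assumes "\<And>i. i \<in> I \<Longrightarrow> f i differentiable (at u)"
  shows "pd a (\<lambda>v. \<Sum>i\<in>I. f i v) u = (\<Sum>i\<in>I. pd a (f i) u)"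
proof -
  have "((\<lambda>v. \<Sum>i\<in>I. f i v) has_derivative
      (\<lambda>y. \<Sum>i\<in>I. frechet_derivative (f i) (at u) y)) (at u)"
    using assms by (auto simp: frechet_derivative_works intro!: derivative_intros)
  from pd_has_derivative[OF this] show ?thesis by (simp add: pd_def)
qed

lemma pd_mult:
  fixes f h :: "real^'n::finite \<Rightarrow> real"
  assumes "f differentiable (at u)" "h differentiable (at u)"
  shows "pd a (\<lambda>v. f v * h v) u = pd a f u * h u + f u * pd a h u"
proof -
  have "((\<lambda>v. f v * h v) has_derivative
      (\<lambda>y. f u * frechet_derivative h (at u) y + frechet_derivative f (at u) y * h u)) (at u)"
    using assms by (auto simp: frechet_derivative_works intro!: derivative_intros)
  from pd_has_derivative[OF this] show ?thesis by (simp add: pd_def)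
qed

lemma differentiable_vec_nth:
  "f differentiable (at u) \<Longrightarrow> (\<lambda>v. f v $ i) differentiable (at u)"
  using bounded_linear.has_derivative[OF bounded_linear_vec_nth]
  unfolding differentiable_def by blast

lemma pd_vec_nth:
  assumes "f differentiable (at u)"
  shows "pd a (\<lambda>v. f v $ i) u = pd a f u $ i"
proof -
  have "((\<lambda>v. f v $ i) has_derivative (\<lambda>y. frechet_derivative f (at u) y $ i)) (at u)"
    using assms bounded_linear.has_derivative[OF bounded_linear_vec_nth]
    by (auto simp: frechet_derivative_works)
  from pd_has_derivative[OF this] show ?thesis by (simp add: pd_def)
qed

lemma differentiable_vec_lambda:
  fixes f :: "'a::real_normed_vector \<Rightarrow> real^'m::finite"
  assumes "\<And>i. (\<lambda>v. f v $ i) differentiable (at u)"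
  shows "f differentiable (at u)"
proof -
  have "((\<lambda>v. f v \<bullet> b)) differentiable (at u)" if "b \<in> Basis" for b
    using that assms by (auto simp: Basis_vec_def inner_axis)
  then show ?thesis by (subst differentiable_componentwise_within) auto
qed

lemma differentiable_chain_vec:
  assumes "x differentiable (at u)" "f differentiable (at (x u))"
  shows "(\<lambda>v. f (x v)) differentiable (at u)"
  using differentiable_chain_at[OF assms] by (simp add: o_def)

lemma pd_chain:
  fixes x :: "real^'n::finite \<Rightarrow> real^'m::finite" and f :: "real^'m \<Rightarrow> real"
  assumes "x differentiable (at u)" "f differentiable (at (x u))"
  shows "pd a (\<lambda>v. f (x v)) u = (\<Sum>k\<in>UNIV. pd k f (x u) * pd a x u $ k)"
proof -
  let ?D = "frechet_derivative f (at (x u))"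
  have lin: "linear ?D" using assms(2) by (rule linear_frechet_derivative)
  have "frechet_derivative (\<lambda>v. f (x v)) (at u) = ?D \<circ> frechet_derivative x (at u)"
    using frechet_derivative_compose[OF assms] by (simp add: o_def)
  then have "pd a (\<lambda>v. f (x v)) u = ?D (pd a x u)" by (simp add: pd_def)
  also have "\<dots> = ?D (\<Sum>k\<in>UNIV. pd a x u $ k *s axis k 1)"
    by (simp add: basis_expansion)
  also have "\<dots> = (\<Sum>k\<in>UNIV. pd a x u $ k * ?D (axis k 1))"
    by (simp add: linear_sum[OF lin] scalar_mult_eq_scaleR linear_cmul[OF lin])
  finally show ?thesis by (simp add: pd_def mult.commute)
qed

section \<open>Symmetry of mixed second partial derivatives\<close>

text \<open>The mean value theorem in direction \<open>i\<close> turns the second difference into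
  \<open>h\<close> times a difference of two values of \<open>pd i f\<close>; both values are then
  replaced by the linearisation of \<open>pd i f\<close> at \<open>u\<close>. This is Young's form
  of the theorem on mixed partials.\<close>

lemma second_difference_estimate:
  fixes f :: "real^'n::finite \<Rightarrow> real"
  assumes U: "open U" "u \<in> U" and f: "\<And>v. v \<in> U \<Longrightarrow> f differentiable (at v)"
    and fi: "pd i f differentiable (at u)" and "e > 0"
  shows "\<exists>\<delta>>0. \<forall>h. 0 < h \<longrightarrow> h < \<delta> \<longrightarrow>
    \<bar>f (u + h *\<^sub>R axis i 1 + h *\<^sub>R axis j 1) - f (u + h *\<^sub>R axis i 1) - f (u + h *\<^sub>R axis j 1) + f u
       - h\<^sup>2 * pd j (pd i f) u\<bar> \<le> e * h\<^sup>2"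
proof -
  let ?D = "frechet_derivative (pd i f) (at u)"
  let ?i = "axis i 1 :: real^'n" and ?j = "axis j 1 :: real^'n"
  have D: "(pd i f has_derivative ?D) (at u)" using fi by (simp add: frechet_derivative_works)
  then have lin: "linear ?D" by (rule has_derivative_linear)
  \<comment> \<open>The share \<open>e/3\<close>: the two linearisation errors below are at most
    \<open>e/3 * (t + h)\<close> and \<open>e/3 * t\<close> with \<open>t < h\<close>, which add up
    to less than \<open>e * h\<close>.\<close>
  from D[unfolded has_derivative_at_alt] \<open>e > 0\<close> obtain d where d: "d > 0"
    "\<And>y. norm (y - u) < d \<Longrightarrow> norm (pd i f y - pd i f u - ?D (y - u)) \<le> e/3 * norm (y - u)"
    by (metis divide_pos_pos zero_less_numeral)
  obtain d' where d': "d' > 0" "ball u d' \<subseteq> U" using U open_contains_ball by blast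
  show ?thesis
  \<comment> \<open>The half is due to points being displaced by up to \<open>h\<close> in each of
    two directions.\<close>
  proof (intro exI[of _ "min d d' / 2"] conjI allI impI)
    show "0 < min d d' / 2" using d d' by simp
    fix h :: real assume h: "0 < h" "h < min d d' / 2"
    have nrm: "norm (t *\<^sub>R ?i + s *\<^sub>R ?j) \<le> \<bar>t\<bar> + \<bar>s\<bar>" for t s :: real
      using norm_triangle_ineq[of "t *\<^sub>R ?i" "s *\<^sub>R ?j"] by simp
    have inU: "u + t *\<^sub>R ?i + s *\<^sub>R ?j \<in> U" if "0 \<le> t" "t \<le> h" "0 \<le> s" "s \<le> h" for t s
    proof -
      have "dist u (u + t *\<^sub>R ?i + s *\<^sub>R ?j) = norm (t *\<^sub>R ?i + s *\<^sub>R ?j)"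
        by (subst dist_commute) (simp add: dist_norm)
      also have "\<dots> < d'" using nrm[of t s] that h by simp
      finally show ?thesis using d'(2) by auto
    qed
    have der: "((\<lambda>t. f (u + t *\<^sub>R ?i + s *\<^sub>R ?j)) has_real_derivative pd i f (u + t *\<^sub>R ?i + s *\<^sub>R ?j)) (at t)"
      if "0 \<le> t" "t \<le> h" "0 \<le> s" "s \<le> h" for t s
    proof -
      let ?F = "frechet_derivative f (at (u + t *\<^sub>R ?i + s *\<^sub>R ?j))"
      have F: "(f has_derivative ?F) (at (u + t *\<^sub>R ?i + s *\<^sub>R ?j))"
        using f[OF inU[OF that]] by (simp add: frechet_derivative_works)
      have 1: "((\<lambda>t. u + t *\<^sub>R ?i + s *\<^sub>R ?j) has_derivative (\<lambda>z. z *\<^sub>R ?i)) (at t)"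
        by (auto intro!: derivative_eq_intros)
      have "((\<lambda>t. f (u + t *\<^sub>R ?i + s *\<^sub>R ?j)) has_derivative (\<lambda>z. ?F (z *\<^sub>R ?i))) (at t)"
        using has_derivative_compose[OF 1 F] .
      moreover have "(\<lambda>z. ?F (z *\<^sub>R ?i)) = (*) (pd i f (u + t *\<^sub>R ?i + s *\<^sub>R ?j))"
        by (rule ext) (simp add: pd_def linear_cmul[OF has_derivative_linear[OF F]])
      ultimately show ?thesis by (simp add: has_field_derivative_def)
    qed
    \<comment> \<open>The difference in direction \<open>j\<close> as a function of the displacement
      in direction \<open>i\<close>; its increment from \<open>0\<close> to \<open>h\<close> is the
      second difference.\<close>
    define \<phi> where "\<phi> t = f (u + t *\<^sub>R ?i + h *\<^sub>R ?j) - f (u + t *\<^sub>R ?i)" for t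
    have "\<exists>t>0. t < h \<and> \<phi> h - \<phi> 0 = (h - 0) * (pd i f (u + t *\<^sub>R ?i + h *\<^sub>R ?j) - pd i f (u + t *\<^sub>R ?i))"
      unfolding \<phi>_def using h(1) by (intro MVT2) (auto intro!: derivative_intros der der[of _ 0, simplified])
    then obtain t where t: "0 < t" "t < h"
      "\<phi> h - \<phi> 0 = h * (pd i f (u + t *\<^sub>R ?i + h *\<^sub>R ?j) - pd i f (u + t *\<^sub>R ?i))"
      by auto
    have A: "\<bar>pd i f (u + t *\<^sub>R ?i + s *\<^sub>R ?j) - pd i f u - (t * ?D ?i + s * ?D ?j)\<bar> \<le> e/3 * (t + s)"
      if "0 \<le> s" "s \<le> h" for s
    proof -
      let ?y = "u + t *\<^sub>R ?i + s *\<^sub>R ?j"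
      have y: "?y - u = t *\<^sub>R ?i + s *\<^sub>R ?j" by simp
      have n: "norm (?y - u) \<le> t + s" unfolding y using nrm[of t s] t that by simp
      moreover have "t + s < d" using t that h by simp
      ultimately have "norm (pd i f ?y - pd i f u - ?D (?y - u)) \<le> e/3 * norm (?y - u)"
        by (intro d(2)) simp
      also have "\<dots> \<le> e/3 * (t + s)" using n \<open>e > 0\<close> by (intro mult_left_mono) auto
      finally show ?thesis unfolding y
        by (simp add: linear_add[OF lin] linear_cmul[OF lin])
    qed
    have "\<bar>(pd i f (u + t *\<^sub>R ?i + h *\<^sub>R ?j) - pd i f (u + t *\<^sub>R ?i)) - h * ?D ?j\<bar> \<le> e/3 * (t + h) + e/3 * t"
    proof -
      have "\<bar>pd i f (u + t *\<^sub>R ?i) - pd i f u - t * ?D ?i\<bar> \<le> e/3 * t" using A[of 0] h by simp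
      then show ?thesis using A[of h] h by linarith
    qed
    also have "\<dots> \<le> e * h"
    proof -
      have "e * t \<le> e * h" using t \<open>e > 0\<close> by simp
      then show ?thesis by (simp add: field_simps)
    qed
    finally have "h * \<bar>(pd i f (u + t *\<^sub>R ?i + h *\<^sub>R ?j) - pd i f (u + t *\<^sub>R ?i)) - h * ?D ?j\<bar> \<le> h * (e * h)"
      using h by (intro mult_left_mono) auto
    moreover have "\<phi> h - \<phi> 0 - h\<^sup>2 * ?D ?j
        = h * ((pd i f (u + t *\<^sub>R ?i + h *\<^sub>R ?j) - pd i f (u + t *\<^sub>R ?i)) - h * ?D ?j)"
      unfolding t(3) by (simp add: power2_eq_square algebra_simps)
    ultimately have "\<bar>\<phi> h - \<phi> 0 - h\<^sup>2 * ?D ?j\<bar> \<le> e * h\<^sup>2"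
      using h(1) by (simp add: abs_mult power2_eq_square mult_ac)
    then show "\<bar>f (u + h *\<^sub>R ?i + h *\<^sub>R ?j) - f (u + h *\<^sub>R ?i) - f (u + h *\<^sub>R ?j) + f u
       - h\<^sup>2 * pd j (pd i f) u\<bar> \<le> e * h\<^sup>2"
      by (simp add: \<phi>_def pd_def algebra_simps)
  qed
qed

text \<open>The second difference is symmetric in \<open>i\<close> and \<open>j\<close>, and after
  division by the square of \<open>h\<close> it approximates both mixed partials.\<close>

lemma pd_commute_real:
  fixes f :: "real^'n::finite \<Rightarrow> real"
  assumes U: "open U" "u \<in> U" and f: "\<And>v. v \<in> U \<Longrightarrow> f differentiable (at v)"
    and "pd i f differentiable (at u)" "pd j f differentiable (at u)"
  shows "pd j (pd i f) u = pd i (pd j f) u"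
proof (rule ccontr)
  let ?a = "pd j (pd i f) u" and ?b = "pd i (pd j f) u"
  assume "?a \<noteq> ?b"
  \<comment> \<open>A third of the gap: the two errors together are at most \<open>2 * e\<close>,
    which is less than the gap.\<close>
  define e where "e = \<bar>?a - ?b\<bar> / 3"
  have e: "e > 0" using \<open>?a \<noteq> ?b\<close> by (simp add: e_def)
  let ?\<Delta> = "\<lambda>h i j. f (u + h *\<^sub>R axis i 1 + h *\<^sub>R axis j 1) - f (u + h *\<^sub>R axis i 1) - f (u + h *\<^sub>R axis j 1) + f u"
  obtain d1 where d1: "d1 > 0" "\<And>h. 0 < h \<Longrightarrow> h < d1 \<Longrightarrow> \<bar>?\<Delta> h i j - h\<^sup>2 * ?a\<bar> \<le> e * h\<^sup>2"
    using second_difference_estimate[OF U f assms(4) e] by blast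
  obtain d2 where d2: "d2 > 0" "\<And>h. 0 < h \<Longrightarrow> h < d2 \<Longrightarrow> \<bar>?\<Delta> h j i - h\<^sup>2 * ?b\<bar> \<le> e * h\<^sup>2"
    using second_difference_estimate[OF U f assms(5) e] by blast
  define h where "h = min d1 d2 / 2"
  have h: "0 < h" "h < d1" "h < d2" using d1 d2 by (auto simp: h_def)
  have "?\<Delta> h i j = ?\<Delta> h j i" by (simp add: add_ac)
  with d1(2)[OF h(1,2)] d2(2)[OF h(1,3)]
  have "\<bar>h\<^sup>2 * ?a - h\<^sup>2 * ?b\<bar> \<le> 2 * e * h\<^sup>2" by linarith
  then have "h\<^sup>2 * \<bar>?a - ?b\<bar> \<le> h\<^sup>2 * (2 * e)"
    by (simp add: right_diff_distrib[symmetric] abs_mult mult_ac)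
  then show False using h(1) e by (simp add: e_def)
qed

lemma pd_commute:
  fixes f :: "real^'n::finite \<Rightarrow> real^'m::finite"
  assumes U: "open U" "u \<in> U" and f: "\<And>v. v \<in> U \<Longrightarrow> f differentiable (at v)"
    and i: "pd i f differentiable (at u)" and j: "pd j f differentiable (at u)"
  shows "pd j (pd i f) u = pd i (pd j f) u"
proof -
  have eq: "pd a (\<lambda>v. f v $ k) v = pd a f v $ k" if "v \<in> U" for a k v
    using pd_vec_nth[OF f[OF that]] .
  have d: "pd a (\<lambda>v. f v $ k) differentiable (at u)" if "pd a f differentiable (at u)" for a k
    by (rule iffD2[OF differentiable_cong_open[OF U] differentiable_vec_nth[OF that]]) (rule eq)
  have "pd j (pd i f) u $ k = pd i (pd j f) u $ k" for k
  proof -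
    have "pd j (pd i f) u $ k = pd j (\<lambda>v. pd i f v $ k) u" by (rule pd_vec_nth[OF i, symmetric])
    also have "\<dots> = pd j (pd i (\<lambda>v. f v $ k)) u" by (rule pd_cong_open[OF U]) (rule eq[symmetric])
    also have "\<dots> = pd i (pd j (\<lambda>v. f v $ k)) u"
      by (rule pd_commute_real[OF U]) (auto intro: d i j f differentiable_vec_nth)
    also have "\<dots> = pd i (\<lambda>v. pd j f v $ k) u" by (rule pd_cong_open[OF U]) (rule eq)
    also have "\<dots> = pd i (pd j f) u $ k" by (rule pd_vec_nth[OF j])
    finally show ?thesis .
  qed
  then show ?thesis by (simp add: vec_eq_iff)
qed

section \<open>Bilinear forms\<close>

lemma mform_eq_inner: "mform Q X Y = X \<bullet> (Q *v Y)"
  by (simp add: mform_def inner_vec_def matrix_vector_mult_def sum_distrib_left mult_ac)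

lemma mform_add_left: "mform Q (X + X') Y = mform Q X Y + mform Q X' Y"
  by (simp add: mform_eq_inner inner_add_left)

lemma mform_add_right: "mform Q X (Y + Y') = mform Q X Y + mform Q X Y'"
  by (simp add: mform_eq_inner inner_add_right matrix_vector_right_distrib)

lemma mform_scale_left: "mform Q (t *\<^sub>R X) Y = t * mform Q X Y"
  by (simp add: mform_eq_inner)

lemma mform_scale_right: "mform Q X (t *\<^sub>R Y) = t * mform Q X Y"
  by (simp add: mform_def sum_distrib_left mult_ac)

lemma mform_minus_left: "mform Q (- X) Y = - mform Q X Y"
  using mform_scale_left[of Q "-1"] by simp

lemma mform_minus_right: "mform Q X (- Y) = - mform Q X Y"
  using mform_scale_right[of Q X "-1"] by simp

lemma mform_diff_left: "mform Q (X - X') Y = mform Q X Y - mform Q X' Y"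
  by (simp add: mform_eq_inner inner_diff_left)

lemma mform_diff_right: "mform Q X (Y - Y') = mform Q X Y - mform Q X Y'"
  by (simp add: mform_eq_inner inner_diff_right matrix_vector_mult_diff_distrib)

lemma mform_zero_left [simp]: "mform Q 0 Y = 0"
  by (simp add: mform_def)

lemma mform_zero_right [simp]: "mform Q X 0 = 0"
  by (simp add: mform_def)

lemma mform_sum_left: "mform Q (\<Sum>i\<in>I. X i) Y = (\<Sum>i\<in>I. mform Q (X i) Y)"
  by (simp add: mform_eq_inner inner_sum_left)

lemma mform_sum_right: "mform Q X (\<Sum>i\<in>I. Y i) = (\<Sum>i\<in>I. mform Q X (Y i))"
  by (induction I rule: infinite_finite_induct) (simp_all add: mform_add_right)

lemma mform_sym:
  assumes "\<And>i j. Q $ i $ j = Q $ j $ i"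
  shows "mform Q X Y = mform Q Y X"
  unfolding mform_def by (subst sum.swap, rule sum.cong[OF refl], rule sum.cong[OF refl])
    (simp add: assms mult_ac)

lemma mform_plus_matrix: "mform (Q + Q') X Y = mform Q X Y + mform Q' X Y"
  by (simp add: mform_def sum.distrib algebra_simps)

lemma mform_transpose_mult: "mform (transpose A ** Q) X Y = mform Q (A *v X) Y"
  by (metis dot_lmul_matrix matrix_vector_mul_assoc mform_eq_inner transpose_matrix_vector transpose_transpose)

lemma mform_mult: "mform (Q ** A) X Y = mform Q X (A *v Y)"
  by (simp add: mform_eq_inner matrix_vector_mul_assoc)

lemmas mform_linear = mform_add_left mform_add_right mform_scale_left mform_scale_right
  mform_minus_left mform_minus_right mform_diff_left mform_diff_right

lemma mform_axis: "mform Q (axis i 1) (axis j 1) = Q $ i $ j"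
  by (simp add: mform_eq_inner matrix_vector_mul_component inner_axis' matrix_vector_mult_basis column_def)

lemma mform_2:
  "mform (Q :: real^2^2) X Y = Q $ 1 $ 1 * X $ 1 * Y $ 1 + Q $ 1 $ 2 * X $ 1 * Y $ 2
     + Q $ 2 $ 1 * X $ 2 * Y $ 1 + Q $ 2 $ 2 * X $ 2 * Y $ 2"
  by (simp add: mform_def sum_2)

section \<open>Matrix inverses and their differentiability\<close>

lemma invertible_of_posdef:
  fixes Q :: "real^'m::finite^'m"
  assumes "\<And>X. X \<noteq> 0 \<Longrightarrow> mform Q X X > 0"
  shows "invertible Q"
proof -
  have "X = 0" if "Q *v X = 0" for X
    using assms[of X] that by (force simp: mform_eq_inner)
  then show ?thesis
    using matrix_left_invertible_ker[of Q] invertible_left_inverse by blast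
qed

lemma matrix_inv_mult:
  fixes Q :: "real^'m::finite^'m"
  assumes "invertible Q"
  shows "Q ** matrix_inv Q = mat 1" "matrix_inv Q ** Q = mat 1"
  using assms someI_ex[of "\<lambda>A'. Q ** A' = mat 1 \<and> A' ** Q = mat 1"]
  unfolding invertible_def matrix_inv_def by blast+

text \<open>Cramer's rule for the \<open>j\<close>-th column of the inverse. As a quotient of
  determinants, an entry is visibly differentiable in the entries of the matrix.\<close>

lemma matrix_inv_entry:
  fixes Q :: "real^'m::finite^'m"
  assumes "invertible Q"
  shows "matrix_inv Q $ i $ j = det (\<chi> k l. if l = i then axis j 1 $ k else Q $ k $ l) / det Q"
proof -
  have "Q *v (matrix_inv Q *v axis j 1) = axis j 1"
    by (simp add: matrix_vector_mul_assoc matrix_inv_mult[OF assms])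
  then have "matrix_inv Q *v axis j 1 =
      (\<chi> i. det (\<chi> k l. if l = i then axis j 1 $ k else Q $ k $ l) / det Q)"
    using cramer[of Q] assms by (simp add: invertible_det_nz)
  moreover have "(matrix_inv Q *v axis j 1) $ i = matrix_inv Q $ i $ j"
    by (simp add: matrix_vector_mult_basis column_def)
  ultimately show ?thesis by simp
qed

lemma matrix_inv_2:
  fixes Q :: "real^2^2"
  assumes "det Q \<noteq> 0"
  shows "matrix_inv Q $ 1 $ 1 = Q $ 2 $ 2 / det Q" "matrix_inv Q $ 1 $ 2 = - Q $ 1 $ 2 / det Q"
    "matrix_inv Q $ 2 $ 1 = - Q $ 2 $ 1 / det Q" "matrix_inv Q $ 2 $ 2 = Q $ 1 $ 1 / det Q"
  using assms by (simp_all add: matrix_inv_entry invertible_det_nz) (simp_all add: det_2 axis_def)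

lemma differentiable_prod_real:
  fixes f :: "'i \<Rightarrow> 'a::real_normed_vector \<Rightarrow> real"
  assumes "\<And>i. i \<in> I \<Longrightarrow> f i differentiable (at u)"
  shows "(\<lambda>v. \<Prod>i\<in>I. f i v) differentiable (at u)"
  using assms by (induction I rule: infinite_finite_induct) simp_all

lemma differentiable_det:
  fixes A :: "'a::real_normed_vector \<Rightarrow> real^'m::finite^'m"
  assumes "\<And>i j. (\<lambda>v. A v $ i $ j) differentiable (at u)"
  shows "(\<lambda>v. det (A v)) differentiable (at u)"
  unfolding det_def
  by (intro differentiable_sum differentiable_mult differentiable_prod_real assms differentiable_const
       finite_permutations ballI) auto

lemma differentiable_matrix_inv:
  fixes A :: "'a::real_normed_vector \<Rightarrow> real^'m::finite^'m"
  assumes "\<And>i j. (\<lambda>v. A v $ i $ j) differentiable (at u)"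
    and S: "open S" "u \<in> S" and inv: "\<And>v. v \<in> S \<Longrightarrow> invertible (A v)"
  shows "(\<lambda>v. matrix_inv (A v) $ i $ j) differentiable (at u)"
proof -
  have "(\<lambda>v. det (\<chi> k l. if l = i then axis j 1 $ k else A v $ k $ l) / det (A v)) differentiable (at u)"
  proof (intro differentiable_divide differentiable_det)
    show "(\<lambda>v. (\<chi> k l. if l = i then axis j 1 $ k else A v $ k $ l) $ k $ l) differentiable (at u)" for k l
      using assms(1) by (cases "l = i") simp_all
    show "(\<lambda>v. A v $ k $ l) differentiable (at u)" for k l by (rule assms)
    show "det (A u) \<noteq> 0" using inv[OF S(2)] by (simp add: invertible_det_nz)
  qed
  then show ?thesis
    using differentiable_cong_open[OF S] matrix_inv_entry[OF inv] by (metis (no_types, lifting))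
qed

text \<open>The vectors \<open>e\<^sub>1, e\<^sub>2, \<nu>\<^sub>A\<close> span, since the linear map sending the standard basis to
  them is injective.\<close>

lemma adapted_frame_expansion:
  fixes Q :: "real^'m::finite^'m" and e1 e2 :: "real^'m" and \<nu> :: "nat \<Rightarrow> real^'m"
  assumes card: "CARD('m) = 2 + p"
    and sym: "\<And>i j. Q $ i $ j = Q $ j $ i"
    and pos: "\<And>X. X \<noteq> 0 \<Longrightarrow> mform Q X X > 0"
    and e: "\<And>s t. s *\<^sub>R e1 + t *\<^sub>R e2 = 0 \<Longrightarrow> s = 0 \<and> t = 0"
    and on: "\<And>A B. A \<in> {1..p} \<Longrightarrow> B \<in> {1..p} \<Longrightarrow> mform Q (\<nu> A) (\<nu> B) = (if A = B then 1 else 0)"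
    and orth: "\<And>A. A \<in> {1..p} \<Longrightarrow> mform Q (\<nu> A) e1 = 0" "\<And>A. A \<in> {1..p} \<Longrightarrow> mform Q (\<nu> A) e2 = 0"
  shows "(mform Q e1 e1 * mform Q e2 e2 - (mform Q e1 e2)\<^sup>2) *
      (mform Q X Y - (\<Sum>A=1..p. mform Q X (\<nu> A) * mform Q Y (\<nu> A))) =
     mform Q e2 e2 * mform Q X e1 * mform Q Y e1
     - mform Q e1 e2 * (mform Q X e1 * mform Q Y e2 + mform Q X e2 * mform Q Y e1)
     + mform Q e1 e1 * mform Q X e2 * mform Q Y e2"
proof -
  let ?q = "mform Q"
  note s = mform_sym[OF sym]
  \<comment> \<open>The abstract index type is numbered so that 0 and 1 stand for \<open>e1\<close>
    and \<open>e2\<close>, and \<open>Suc A\<close> for the normal vector with index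
    \<open>A\<close>.\<close>
  obtain b :: "'m \<Rightarrow> nat" where b: "bij_betw b UNIV {0..<2 + p}"
    using ex_bij_betw_finite_nat[of "UNIV :: 'm set"] card by auto
  define f where "f k = (if k = 0 then e1 else if k = 1 then e2 else \<nu> (k - 1))" for k :: nat
  define \<Phi> where "\<Phi> z = (\<Sum>i\<in>UNIV. z $ i *\<^sub>R f (b i))" for z :: "real^'m"
  have lin: "linear \<Phi>" unfolding \<Phi>_def
    by (intro linear_compose_sum ballI linear_compose_scale_right) (auto intro!: linearI simp: algebra_simps)
  have reindex: "(\<Sum>i\<in>UNIV. h (b i)) = h 0 + h 1 + (\<Sum>A=1..p. h (Suc A))" for h :: "nat \<Rightarrow> 'b::comm_monoid_add"
  proof -
    have "(\<Sum>i\<in>UNIV. h (b i)) = (\<Sum>k\<in>{0..<2+p}. h k)"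
      using sum.reindex_bij_betw[OF b] .
    also have "{0..<2+p} = {0,1} \<union> Suc ` {1..p}"
      by (auto simp: image_Suc_atLeastAtMost)
    also have "(\<Sum>k\<in>\<dots>. h k) = (\<Sum>k\<in>{0,1}. h k) + (\<Sum>k\<in>Suc ` {1..p}. h k)"
      by (rule sum.union_disjoint) auto
    also have "(\<Sum>k\<in>Suc ` {1..p}. h k) = (\<Sum>A=1..p. h (Suc A))"
      by (subst sum.reindex) (auto simp: o_def)
    finally show ?thesis by simp
  qed
  define ib where "ib = inv b"
  have injb: "inj b" and ib: "\<And>k. k < 2 + p \<Longrightarrow> b (ib k) = k"
    using b unfolding ib_def bij_betw_def by (auto intro!: f_inv_into_f)
  have ibb: "ib (b i) = i" for i using injb by (simp add: ib_def)
  have \<Phi>: "\<Phi> z = z $ ib 0 *\<^sub>R e1 + z $ ib 1 *\<^sub>R e2 + (\<Sum>A=1..p. z $ ib (Suc A) *\<^sub>R \<nu> A)" for z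
  proof -
    have "\<Phi> z = (\<Sum>i\<in>UNIV. z $ ib (b i) *\<^sub>R f (b i))" unfolding \<Phi>_def ibb ..
    also have "\<dots> = z $ ib 0 *\<^sub>R f 0 + z $ ib 1 *\<^sub>R f 1 + (\<Sum>A=1..p. z $ ib (Suc A) *\<^sub>R f (Suc A))"
      by (rule reindex)
    finally show ?thesis by (simp add: f_def)
  qed
  have "inj \<Phi>"
  proof (rule linear_injective_0[OF lin, THEN iffD2], intro allI impI)
    fix z assume 0: "\<Phi> z = 0"
    \<comment> \<open>Pairing with a normal vector isolates its coefficient; what remains is a
      relation between \<open>e1\<close> and \<open>e2\<close>.\<close>
    have nu: "z $ ib (Suc B) = 0" if B: "B \<in> {1..p}" for B
    proof -
      have "0 = ?q (\<Phi> z) (\<nu> B)" using 0 by simp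
      also have "\<dots> = (\<Sum>A=1..p. z $ ib (Suc A) * (if A = B then 1 else 0))"
        unfolding \<Phi> using B orth s[of e1 "\<nu> B"] s[of e2 "\<nu> B"]
        by (auto simp: mform_linear mform_sum_left on intro!: sum.cong)
      also have "\<dots> = z $ ib (Suc B)" using B by (simp add: if_distrib cong: if_cong)
      finally show ?thesis by simp
    qed
    have "z $ ib 0 *\<^sub>R e1 + z $ ib 1 *\<^sub>R e2 = 0" using 0 nu unfolding \<Phi> by simp
    have "z $ ib k = 0" if "k < 2 + p" for k
    proof (cases "k = 0 \<or> k = 1")
      case False
      then have "k - 1 \<in> {1..p}" "Suc (k - 1) = k" using that by auto
      then show ?thesis using nu by metis
    qed (use e[OF \<open>z $ ib 0 *\<^sub>R e1 + z $ ib 1 *\<^sub>R e2 = 0\<close>] in auto)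
    moreover have "b i < 2 + p" for i using bij_betwE[OF b] by simp
    ultimately have "z $ ib (b i) = 0" for i by blast
    then show "z = 0" by (simp add: ibb vec_eq_iff)
  qed
  then have surj: "surj \<Phi>" using linear_injective_imp_surjective[OF lin] by simp
  define D where "D = ?q e1 e1 * ?q e2 e2 - (?q e1 e2)\<^sup>2"
  \<comment> \<open>\<open>D\<close> times the residue of \<open>X\<close> after its orthogonal
    projection to the span of the frame. The coefficients of \<open>e1\<close> and \<open>e2\<close>
    come from the adjugate of their Gram matrix, whose determinant is \<open>D\<close>. This residue
    is orthogonal to the frame and, the frame being spanning, to itself; so it vanishes, and pairing
    it with \<open>Y\<close> is the claim.\<close>
  define Z where "Z = D *\<^sub>R (X - (\<Sum>A=1..p. ?q X (\<nu> A) *\<^sub>R \<nu> A))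
     - (?q e2 e2 * ?q X e1 - ?q e1 e2 * ?q X e2) *\<^sub>R e1
     - (?q e1 e1 * ?q X e2 - ?q e1 e2 * ?q X e1) *\<^sub>R e2"
  have Z1: "?q Z e1 = 0" unfolding Z_def D_def using orth s
    by (simp add: mform_linear mform_sum_left algebra_simps power2_eq_square s[of e2 e1])
  have Z2: "?q Z e2 = 0" unfolding Z_def D_def using orth s
    by (simp add: mform_linear mform_sum_left algebra_simps power2_eq_square)
  have ZB: "?q Z (\<nu> B) = 0" if B: "B \<in> {1..p}" for B
  proof -
    have "?q Z (\<nu> B) = D * (?q X (\<nu> B) - (\<Sum>A=1..p. ?q X (\<nu> A) * (if A = B then 1 else 0)))"
      unfolding Z_def using B orth s[of e1 "\<nu> B"] s[of e2 "\<nu> B"]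
      by (auto simp: mform_linear mform_sum_left on intro!: sum.cong)
    also have "\<dots> = 0" using B by (simp add: if_distrib cong: if_cong)
    finally show ?thesis .
  qed
  obtain z where z: "Z = \<Phi> z" using surj by auto
  have "?q Z (\<Phi> z) = 0"
    unfolding \<Phi> by (simp add: mform_linear mform_sum_right Z1 Z2 ZB)
  then have "Z = 0" using pos[of Z] z by auto
  then have "?q Z Y = 0" by simp
  then show ?thesis unfolding Z_def D_def
    by (simp add: mform_linear mform_sum_left s[of e1 Y] s[of e2 Y] s[of "\<nu> _" Y] algebra_simps)
qed

section \<open>The Levi-Civita connection in coordinates\<close>

text \<open>Two derivatives at each point of an open set are asked for, so that the induced metric
  of a three times differentiable parametrisation is again an instance.\<close>

locale metric_on =
  fixes G :: "real^'m::finite \<Rightarrow> real^'m^'m" and V :: "(real^'m) set"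
  assumes open_V: "open V"
    and G_sym: "y \<in> V \<Longrightarrow> G y $ i $ j = G y $ j $ i"
    and G_pos: "y \<in> V \<Longrightarrow> X \<noteq> 0 \<Longrightarrow> mform (G y) X X > 0"
    and G_diff: "y \<in> V \<Longrightarrow> (\<lambda>z. G z $ i $ j) differentiable (at y)"
    and G_diff2: "y \<in> V \<Longrightarrow> pd k (\<lambda>z. G z $ i $ j) differentiable (at y)"
begin

lemma G_invertible: "y \<in> V \<Longrightarrow> invertible (G y)"
  by (rule invertible_of_posdef) (rule G_pos)

lemma pd_G_sym: "y \<in> V \<Longrightarrow> pd k (\<lambda>z. G z $ i $ j) y = pd k (\<lambda>z. G z $ j $ i) y"
  by (rule pd_cong_open[OF open_V]) (auto intro: G_sym)

lemma christoffel_sym: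
  assumes "y \<in> V"
  shows "christoffel G i j k y = christoffel G i k j y"
  unfolding christoffel_def by (simp add: pd_G_sym[OF assms, of _ j k] add.commute)

lemma christoffel_lower:
  assumes "y \<in> V"
  shows "(\<Sum>q\<in>UNIV. G y $ l $ q * christoffel G q j k y) =
    (pd j (\<lambda>z. G z $ k $ l) y + pd k (\<lambda>z. G z $ j $ l) y - pd l (\<lambda>z. G z $ j $ k) y) / 2"
proof -
  define B where "B r = pd j (\<lambda>z. G z $ k $ r) y + pd k (\<lambda>z. G z $ j $ r) y - pd r (\<lambda>z. G z $ j $ k) y" for r
  have "(\<Sum>q\<in>UNIV. G y $ l $ q * christoffel G q j k y)
      = (\<Sum>q\<in>UNIV. \<Sum>r\<in>UNIV. G y $ l $ q * matrix_inv (G y) $ q $ r * B r / 2)"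
    by (simp add: christoffel_def B_def sum_distrib_left mult_ac)
  also have "\<dots> = (\<Sum>r\<in>UNIV. \<Sum>q\<in>UNIV. G y $ l $ q * matrix_inv (G y) $ q $ r * B r / 2)"
    by (rule sum.swap)
  also have "\<dots> = (\<Sum>r\<in>UNIV. (G y ** matrix_inv (G y)) $ l $ r * B r / 2)"
    by (simp add: matrix_matrix_mult_def sum_distrib_right sum_divide_distrib)
  also have "\<dots> = (\<Sum>r\<in>UNIV. if r = l then B r / 2 else 0)"
    by (rule sum.cong) (auto simp: matrix_inv_mult[OF G_invertible[OF assms]] mat_def)
  also have "\<dots> = B l / 2" by simp
  finally show ?thesis by (simp add: B_def)
qed

text \<open>Compatibility of the connection with the metric: in the sum of the two lowered symbols
  every derivative except that in direction \<open>k\<close> cancels.\<close>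

lemma G_parallel:
  assumes "y \<in> V"
  shows "pd k (\<lambda>z. G z $ i $ j) y =
    (\<Sum>q\<in>UNIV. christoffel G q k i y * G y $ q $ j) + (\<Sum>q\<in>UNIV. G y $ i $ q * christoffel G q k j y)"
proof -
  have "(\<Sum>q\<in>UNIV. christoffel G q k i y * G y $ q $ j) = (\<Sum>q\<in>UNIV. G y $ j $ q * christoffel G q k i y)"
    by (simp add: G_sym[OF assms, of _ j] mult.commute)
  then show ?thesis
    unfolding christoffel_lower[OF assms]
    by (simp add: christoffel_lower[OF assms] pd_G_sym[OF assms, of _ j] field_simps)
qed

lemma christoffel_differentiable:
  assumes "y \<in> V"
  shows "christoffel G i j k differentiable (at y)"
proof -
  have "(\<lambda>z. matrix_inv (G z) $ i $ l) differentiable (at y)" for l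
    by (rule differentiable_matrix_inv[OF _ open_V assms]) (auto intro: G_diff G_invertible assms)
  then show ?thesis
    unfolding christoffel_def[abs_def]
    by (intro differentiable_mult differentiable_const differentiable_sum differentiable_add
        differentiable_diff G_diff2 assms ballI) auto
qed

end

section \<open>The covariant derivative along a parametrised surface\<close>

text \<open>The pulled-back connection form \<omega>: the covariant derivative becomes a partial
  derivative plus multiplication by this matrix, so that index computations turn into matrix
  algebra.\<close>

definition connection_matrix ::
  "(real^'m::finite \<Rightarrow> real^'m^'m) \<Rightarrow> (real^'n::finite \<Rightarrow> real^'m) \<Rightarrow> 'n \<Rightarrow> real^'n \<Rightarrow> real^'m^'m" where
  "connection_matrix G x a u = (\<chi> q i. \<Sum>k\<in>UNIV. christoffel G q k i (x u) * pd a x u $ k)"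

lemma cov_along_matrix: "cov_along G x Y a u = pd a Y u + connection_matrix G x a u *v Y u"
  unfolding cov_along_def connection_matrix_def matrix_vector_mult_def
  by (simp add: vec_eq_iff sum_distrib_right, subst sum.swap, simp)

lemma pd_matrix_vector_mult:
  fixes A :: "real^'n::finite \<Rightarrow> real^'m::finite^'k::finite"
  assumes A: "\<And>i j. (\<lambda>v. A v $ i $ j) differentiable (at u)" and Y: "Y differentiable (at u)"
  shows "(\<lambda>v. A v *v Y v) differentiable (at u)" (is ?A)
    and "pd a (\<lambda>v. A v *v Y v) u = (\<chi> i j. pd a (\<lambda>v. A v $ i $ j) u) *v Y u + A u *v pd a Y u" (is ?B)
proof -
  have Yj: "(\<lambda>v. Y v $ j) differentiable (at u)" for j using Y by (rule differentiable_vec_nth)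
  show ?A
    by (rule differentiable_vec_lambda, simp add: matrix_vector_mult_def,
        intro differentiable_sum differentiable_mult A Yj ballI finite)
  show ?B
  proof (subst vec_eq_iff, intro allI)
    fix i
    have "pd a (\<lambda>v. A v *v Y v) u $ i = pd a (\<lambda>v. \<Sum>j\<in>UNIV. A v $ i $ j * Y v $ j) u"
      using pd_vec_nth[OF \<open>?A\<close>, of a i] by (simp add: matrix_vector_mult_def)
    also have "\<dots> = (\<Sum>j\<in>UNIV. pd a (\<lambda>v. A v $ i $ j) u * Y u $ j + A u $ i $ j * pd a Y u $ j)"
      by (subst pd_sum) (simp_all add: A Yj pd_mult pd_vec_nth[OF Y])
    finally show "pd a (\<lambda>v. A v *v Y v) u $ i =
        ((\<chi> i j. pd a (\<lambda>v. A v $ i $ j) u) *v Y u + A u *v pd a Y u) $ i"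
      by (simp add: matrix_vector_mult_def sum.distrib)
  qed
qed

locale patch = metric_on G V for G :: "real^'m::finite \<Rightarrow> real^'m^'m" and V +
  fixes x :: "real^2 \<Rightarrow> real^'m" and U :: "(real^2) set"
  assumes open_U: "open U"
    and x_in: "u \<in> U \<Longrightarrow> x u \<in> V"
    and x_diff: "u \<in> U \<Longrightarrow> x differentiable (at u)"
    and x_diff2: "u \<in> U \<Longrightarrow> pd a x differentiable (at u)"
    and x_diff3: "u \<in> U \<Longrightarrow> pd b (pd a x) differentiable (at u)"
begin

abbreviation ip ("\<langle>_,/ _\<rangle>\<^bsub>_\<^esub>") where "\<langle>X, Y\<rangle>\<^bsub>u\<^esub> \<equiv> mform (G (x u)) X Y"
abbreviation D where "D a Y \<equiv> cov_along G x Y a"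
abbreviation \<omega> where "\<omega> \<equiv> connection_matrix G x"

lemma ip_sym: "u \<in> U \<Longrightarrow> \<langle>X, Y\<rangle>\<^bsub>u\<^esub> = \<langle>Y, X\<rangle>\<^bsub>u\<^esub>"
  by (rule mform_sym) (auto intro: G_sym x_in)

lemma christoffel_along:
  assumes "u \<in> U"
  shows "(\<lambda>v. christoffel G i j k (x v)) differentiable (at u)"
    and "pd a (\<lambda>v. christoffel G i j k (x v)) u = (\<Sum>q\<in>UNIV. pd q (christoffel G i j k) (x u) * pd a x u $ q)"
proof -
  show "(\<lambda>v. christoffel G i j k (x v)) differentiable (at u)"
    by (rule differentiable_chain_vec) (auto intro: assms x_in x_diff christoffel_differentiable)
  show "pd a (\<lambda>v. christoffel G i j k (x v)) u = (\<Sum>q\<in>UNIV. pd q (christoffel G i j k) (x u) * pd a x u $ q)"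
    by (rule pd_chain) (auto intro: assms x_in x_diff christoffel_differentiable)
qed

lemma \<omega>_diff:
  assumes "u \<in> U"
  shows "(\<lambda>v. \<omega> a v $ i $ j) differentiable (at u)"
  unfolding connection_matrix_def
  by (simp, intro differentiable_sum differentiable_mult ballI finite christoffel_along
      differentiable_vec_nth x_diff2 assms)

lemma pd_\<omega>:
  assumes "u \<in> U"
  shows "pd b (\<lambda>v. \<omega> a v $ i $ j) u =
    (\<Sum>l\<in>UNIV. \<Sum>k\<in>UNIV. pd k (christoffel G i l j) (x u) * pd b x u $ k * pd a x u $ l)
    + (\<Sum>l\<in>UNIV. christoffel G i l j (x u) * pd b (pd a x) u $ l)"
  unfolding connection_matrix_def
  by (simp add: pd_sum pd_mult christoffel_along[OF assms] differentiable_vec_nth x_diff2[OF assms]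
      pd_vec_nth sum.distrib sum_distrib_right)

text \<open>\<open>G_parallel\<close> pulled back by the chain rule. In matrix shape each of the two
  terms can be moved onto one argument of the metric.\<close>

lemma pd_G_along:
  assumes "u \<in> U"
  shows "pd a (\<lambda>v. G (x v) $ i $ j) u = (transpose (\<omega> a u) ** G (x u) + G (x u) ** \<omega> a u) $ i $ j"
proof -
  note y = x_in[OF assms]
  have "pd a (\<lambda>v. G (x v) $ i $ j) u = (\<Sum>k\<in>UNIV. pd k (\<lambda>z. G z $ i $ j) (x u) * pd a x u $ k)"
    by (rule pd_chain[OF x_diff[OF assms] G_diff[OF y]])
  also have "\<dots> = (\<Sum>k\<in>UNIV. \<Sum>q\<in>UNIV. christoffel G q k i (x u) * G (x u) $ q $ j * pd a x u $ k)
      + (\<Sum>k\<in>UNIV. \<Sum>q\<in>UNIV. G (x u) $ i $ q * christoffel G q k j (x u) * pd a x u $ k)"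
    by (simp add: G_parallel[OF y] distrib_right sum.distrib sum_distrib_right)
  also have "\<dots> = (\<Sum>q\<in>UNIV. \<Sum>k\<in>UNIV. christoffel G q k i (x u) * G (x u) $ q $ j * pd a x u $ k)
      + (\<Sum>q\<in>UNIV. \<Sum>k\<in>UNIV. G (x u) $ i $ q * christoffel G q k j (x u) * pd a x u $ k)"
    by (intro arg_cong2[where f="(+)"] sum.swap)
  also have "\<dots> = (transpose (\<omega> a u) ** G (x u) + G (x u) ** \<omega> a u) $ i $ j"
    by (simp add: matrix_matrix_mult_def transpose_def connection_matrix_def sum_distrib_left
        sum_distrib_right mult_ac)
  finally show ?thesis .
qed

lemma G_along_diff: "u \<in> U \<Longrightarrow> (\<lambda>v. G (x v) $ i $ j) differentiable (at u)"
  using differentiable_chain_vec[of x u "\<lambda>z. G z $ i $ j"] x_diff G_diff x_in by blast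

lemma ip_diff:
  assumes "u \<in> U" "Y differentiable (at u)" "Z differentiable (at u)"
  shows "(\<lambda>v. \<langle>Y v, Z v\<rangle>\<^bsub>v\<^esub>) differentiable (at u)"
  unfolding mform_def
  by (intro differentiable_sum differentiable_mult ballI finite G_along_diff assms(1)
      differentiable_vec_nth[OF assms(2)] differentiable_vec_nth[OF assms(3)])

text \<open>The product rule has a third term, from differentiating the metric; by
  \<open>pd_G_along\<close> it supplies exactly the connection terms of the two covariant
  derivatives.\<close>

lemma pd_ip:
  assumes "u \<in> U" and Y: "Y differentiable (at u)" and Z: "Z differentiable (at u)"
  shows "pd a (\<lambda>v. \<langle>Y v, Z v\<rangle>\<^bsub>v\<^esub>) u = \<langle>D a Y u, Z u\<rangle>\<^bsub>u\<^esub> + \<langle>Y u, D a Z u\<rangle>\<^bsub>u\<^esub>"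
proof -
  note d = differentiable_vec_nth[OF Y] differentiable_vec_nth[OF Z] G_along_diff[OF assms(1)]
  let ?dG = "transpose (\<omega> a u) ** G (x u) + G (x u) ** \<omega> a u"
  have "pd a (\<lambda>v. \<langle>Y v, Z v\<rangle>\<^bsub>v\<^esub>) u = mform ?dG (Y u) (Z u) + \<langle>pd a Y u, Z u\<rangle>\<^bsub>u\<^esub> + \<langle>Y u, pd a Z u\<rangle>\<^bsub>u\<^esub>"
    unfolding mform_def
    by (simp add: pd_sum pd_mult d pd_vec_nth[OF Y] pd_vec_nth[OF Z] pd_G_along[OF assms(1)]
        distrib_right sum.distrib del: vector_add_component)
  then show ?thesis
    unfolding mform_plus_matrix mform_transpose_mult
    by (simp add: mform_mult cov_along_matrix mform_linear)
qed

lemma D_diff: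
  assumes "u \<in> U" "Y differentiable (at u)" "pd a Y differentiable (at u)"
  shows "D a Y differentiable (at u)"
  unfolding cov_along_matrix[abs_def]
  by (intro differentiable_add pd_matrix_vector_mult assms \<omega>_diff)

text \<open>Both parts of the covariant derivative are symmetric: the mixed partials of
  \<open>x\<close>, and the Christoffel symbols in their lower indices.\<close>

lemma D_torsion_free:
  assumes "u \<in> U"
  shows "D a (pd b x) u = D b (pd a x) u"
proof -
  have "pd a (pd b x) u = pd b (pd a x) u"
    by (rule pd_commute[OF open_U]) (auto intro: x_diff x_diff2 assms)
  moreover have "\<omega> a u *v pd b x u = \<omega> b u *v pd a x u"
    unfolding vec_eq_iff
  proof
    fix i
    have "(\<omega> a u *v pd b x u) $ i = (\<Sum>j\<in>UNIV. \<Sum>k\<in>UNIV. christoffel G i k j (x u) * pd a x u $ k * pd b x u $ j)"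
      by (simp add: connection_matrix_def matrix_vector_mult_def sum_distrib_right)
    also have "\<dots> = (\<Sum>k\<in>UNIV. \<Sum>j\<in>UNIV. christoffel G i k j (x u) * pd a x u $ k * pd b x u $ j)"
      by (rule sum.swap)
    also have "\<dots> = (\<omega> b u *v pd a x u) $ i"
      by (simp add: connection_matrix_def matrix_vector_mult_def sum_distrib_left mult_ac
          christoffel_sym[OF x_in[OF assms], of i])
    finally show "(\<omega> a u *v pd b x u) $ i = (\<omega> b u *v pd a x u) $ i" .
  qed
  ultimately show ?thesis by (simp add: cov_along_matrix)
qed

lemma pd_D:
  assumes "u \<in> U" "Y differentiable (at u)" "pd b Y differentiable (at u)"
  shows "D a (D b Y) u = pd a (pd b Y) u + (\<chi> i j. pd a (\<lambda>v. \<omega> b v $ i $ j) u) *v Y u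
    + \<omega> b u *v pd a Y u + \<omega> a u *v pd b Y u + (\<omega> a u ** \<omega> b u) *v Y u"
proof -
  note w = pd_matrix_vector_mult[OF \<omega>_diff[OF assms(1)] assms(2)]
  have "pd a (D b Y) u = pd a (pd b Y) u + pd a (\<lambda>v. \<omega> b v *v Y v) u"
    unfolding cov_along_matrix[abs_def] by (rule pd_add[OF assms(3) w(1)])
  then show ?thesis
    by (subst cov_along_matrix)
      (simp add: w(2) cov_along_matrix matrix_vector_right_distrib matrix_vector_mul_assoc)
qed

text \<open>In \<open>pd_D\<close> the second derivatives of \<open>Y\<close> and the two terms with
  one derivative of \<open>Y\<close> are symmetric in \<open>a\<close> and \<open>b\<close>. What
  survives is a matrix acting on \<open>Y u\<close>, the curvature form d\<omega> + \<omega> \<and>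
  \<omega>, whose entries are those of the Riemann tensor contracted with the tangent
  vectors.\<close>

lemma D_commutator:
  assumes "u \<in> U" "Y differentiable (at u)" "pd a Y differentiable (at u)" "pd b Y differentiable (at u)"
    and "pd a (pd b Y) u = pd b (pd a Y) u"
  shows "D a (D b Y) u - D b (D a Y) u = curvature G (x u) (pd a x u) (pd b x u) (Y u)"
proof -
  let ?\<Gamma> = "\<lambda>i j k. christoffel G i j k (x u)"
  let ?R = "(\<chi> i j. pd a (\<lambda>v. \<omega> b v $ i $ j) u) - (\<chi> i j. pd b (\<lambda>v. \<omega> a v $ i $ j) u)
     + \<omega> a u ** \<omega> b u - \<omega> b u ** \<omega> a u"
  have sym: "pd a (pd b x) u = pd b (pd a x) u"
    by (rule pd_commute[OF open_U]) (auto intro: x_diff x_diff2 assms)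
  have prod: "(\<omega> c u ** \<omega> d u) $ i $ j =
      (\<Sum>k\<in>UNIV. \<Sum>l\<in>UNIV. (\<Sum>q\<in>UNIV. ?\<Gamma> i k q * ?\<Gamma> q l j) * pd c x u $ k * pd d x u $ l)" for c d i j
  proof -
    have "(\<omega> c u ** \<omega> d u) $ i $ j =
      (\<Sum>q\<in>UNIV. \<Sum>k\<in>UNIV. \<Sum>l\<in>UNIV. ?\<Gamma> i k q * ?\<Gamma> q l j * pd c x u $ k * pd d x u $ l)"
      by (simp add: matrix_matrix_mult_def connection_matrix_def sum_product mult_ac)
    also have "\<dots> = (\<Sum>k\<in>UNIV. \<Sum>q\<in>UNIV. \<Sum>l\<in>UNIV. ?\<Gamma> i k q * ?\<Gamma> q l j * pd c x u $ k * pd d x u $ l)"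
      by (rule sum.swap)
    also have "\<dots> = (\<Sum>k\<in>UNIV. \<Sum>l\<in>UNIV. \<Sum>q\<in>UNIV. ?\<Gamma> i k q * ?\<Gamma> q l j * pd c x u $ k * pd d x u $ l)"
      by (rule sum.cong[OF refl], rule sum.swap)
    finally show ?thesis by (simp add: sum_distrib_right)
  qed
  have R: "?R $ i $ j = (\<Sum>k\<in>UNIV. \<Sum>l\<in>UNIV. riemann G i j k l (x u) * pd a x u $ k * pd b x u $ l)" for i j
  proof -
    \<comment> \<open>The terms with second derivatives of \<open>x\<close> cancel by
      \<open>sym\<close>, so only derivatives of Christoffel symbols remain.\<close>
    have 1: "pd a (\<lambda>v. \<omega> b v $ i $ j) u - pd b (\<lambda>v. \<omega> a v $ i $ j) u =
      (\<Sum>k\<in>UNIV. \<Sum>l\<in>UNIV. pd k (christoffel G i l j) (x u) * pd a x u $ k * pd b x u $ l)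
      - (\<Sum>k\<in>UNIV. \<Sum>l\<in>UNIV. pd l (christoffel G i k j) (x u) * pd a x u $ k * pd b x u $ l)"
      unfolding pd_\<omega>[OF assms(1)] sym
      by (subst (1) sum.swap) (simp add: mult_ac)
    have 2: "(\<omega> b u ** \<omega> a u) $ i $ j =
      (\<Sum>k\<in>UNIV. \<Sum>l\<in>UNIV. (\<Sum>q\<in>UNIV. ?\<Gamma> i l q * ?\<Gamma> q k j) * pd a x u $ k * pd b x u $ l)"
      unfolding prod by (subst sum.swap) (simp add: mult_ac)
    have "?R $ i $ j = (pd a (\<lambda>v. \<omega> b v $ i $ j) u - pd b (\<lambda>v. \<omega> a v $ i $ j) u)
        + (\<omega> a u ** \<omega> b u) $ i $ j - (\<omega> b u ** \<omega> a u) $ i $ j" by simp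
    also have "\<dots> = (\<Sum>k\<in>UNIV. \<Sum>l\<in>UNIV. riemann G i j k l (x u) * pd a x u $ k * pd b x u $ l)"
      unfolding 1 2 prod[of a b i j] riemann_def
      by (simp add: sum.distrib sum_subtractf algebra_simps)
    finally show ?thesis .
  qed
  have "D a (D b Y) u - D b (D a Y) u = ?R *v Y u"
    unfolding pd_D[OF assms(1,2,4)] pd_D[OF assms(1,2,3)] assms(5)
    by (simp add: matrix_vector_mult_add_rdistrib matrix_vector_mult_diff_rdistrib algebra_simps)
  also have "\<dots> = curvature G (x u) (pd a x u) (pd b x u) (Y u)"
    unfolding vec_eq_iff curvature_def matrix_vector_mult_def R
    by (simp add: sum_distrib_right)
  finally show ?thesis .
qed

end

section \<open>The Gauss equation\<close>

text \<open>The lowered index comes first. Only the entries of the given metric occur, so the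
  surface and its intrinsic copy share these values.\<close>

definition christoffel_first ::
  "(real^'n::finite \<Rightarrow> real^'n^'n) \<Rightarrow> 'n \<Rightarrow> 'n \<Rightarrow> 'n \<Rightarrow> real^'n \<Rightarrow> real" where
  "christoffel_first g c a b u =
     (pd a (\<lambda>v. g v $ b $ c) u + pd b (\<lambda>v. g v $ a $ c) u - pd c (\<lambda>v. g v $ a $ b) u) / 2"

lemma mform_induced_metric:
  "mform (induced_metric G x u) X Y = X $ 1 * Y $ 1 * mform (G (x u)) (pd 1 x u) (pd 1 x u)
    + X $ 1 * Y $ 2 * mform (G (x u)) (pd 1 x u) (pd 2 x u)
    + X $ 2 * Y $ 1 * mform (G (x u)) (pd 2 x u) (pd 1 x u)
    + X $ 2 * Y $ 2 * mform (G (x u)) (pd 2 x u) (pd 2 x u)"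
  unfolding mform_2 unfolding induced_metric_def by simp

context patch begin

abbreviation e where "e a \<equiv> pd a x"

lemma D_e_differentiable: "u \<in> U \<Longrightarrow> D a (e b) differentiable (at u)"
  by (rule D_diff) (auto intro: x_diff2 x_diff3)

lemma pd_induced_metric:
  assumes "u \<in> U"
  shows "pd c (\<lambda>v. induced_metric G x v $ a $ b) u = \<langle>D c (e a) u, e b u\<rangle>\<^bsub>u\<^esub> + \<langle>e a u, D c (e b) u\<rangle>\<^bsub>u\<^esub>"
  unfolding induced_metric_def by (simp add: pd_ip[OF assms] x_diff2 assms)

text \<open>This makes the induced metric an instance of \<open>metric_on\<close>; its second
  derivatives consume the third derivatives of \<open>x\<close>.\<close>

lemma induced_metric_differentiable:
  assumes "u \<in> U"
  shows "(\<lambda>v. induced_metric G x v $ a $ b) differentiable (at u)"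
    and "pd c (\<lambda>v. induced_metric G x v $ a $ b) differentiable (at u)"
proof -
  show "(\<lambda>v. induced_metric G x v $ a $ b) differentiable (at u)"
    unfolding induced_metric_def by (simp add: ip_diff x_diff2 assms)
  have "(\<lambda>u. \<langle>D c (e a) u, e b u\<rangle>\<^bsub>u\<^esub> + \<langle>e a u, D c (e b) u\<rangle>\<^bsub>u\<^esub>) differentiable (at u)"
    by (intro differentiable_add ip_diff D_e_differentiable x_diff2 assms)
  then show "pd c (\<lambda>v. induced_metric G x v $ a $ b) differentiable (at u)"
    by (rule iffD2[OF differentiable_cong_open[OF open_U assms], rotated]) (rule pd_induced_metric)
qed

lemma induced_metric_sym: "u \<in> U \<Longrightarrow> induced_metric G x u $ a $ b = induced_metric G x u $ b $ a"
  unfolding induced_metric_def using ip_sym[of u "e a u" "e b u"] by simp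

text \<open>Koszul's argument: compatibility with the metric expands the three derivatives into six
  products, and freedom from torsion cancels four of them, leaving twice the same product.\<close>

lemma christoffel_first_induced:
  assumes "u \<in> U"
  shows "\<langle>D a (e b) u, e c u\<rangle>\<^bsub>u\<^esub> = christoffel_first (induced_metric G x) c a b u"
  unfolding christoffel_first_def pd_induced_metric[OF assms]
    D_torsion_free[OF assms, where a = b and b = a] D_torsion_free[OF assms, where a = c and b = a]
    D_torsion_free[OF assms, where a = c and b = b] ip_sym[OF assms, of "e b u" "D a (e c) u"]
  by simp

lemma curvature_e:
  assumes "u \<in> U"
  defines "\<Gamma> \<equiv> christoffel_first (induced_metric G x)"
  shows "\<langle>curvature G (x u) (e 1 u) (e 2 u) (e 2 u), e 1 u\<rangle>\<^bsub>u\<^esub> =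
    pd 1 (\<Gamma> 1 2 2) u - pd 2 (\<Gamma> 1 1 2) u
    - \<langle>D 2 (e 2) u, D 1 (e 1) u\<rangle>\<^bsub>u\<^esub> + \<langle>D 1 (e 2) u, D 1 (e 2) u\<rangle>\<^bsub>u\<^esub>"
proof -
  have comm: "pd 1 (pd 2 (e 2)) u = pd 2 (pd 1 (e 2)) u"
    by (rule pd_commute[OF open_U]) (auto intro: x_diff2 x_diff3 assms(1))
  \<comment> \<open>The symbol agrees with a product of vector fields on all of \<open>U\<close>,
    hence may be differentiated once more by the product rule.\<close>
  have 1: "pd a (\<Gamma> 1 b 2) u = \<langle>D a (D b (e 2)) u, e 1 u\<rangle>\<^bsub>u\<^esub> + \<langle>D b (e 2) u, D a (e 1) u\<rangle>\<^bsub>u\<^esub>" for a b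
  proof -
    have "pd a (\<Gamma> 1 b 2) u = pd a (\<lambda>v. \<langle>D b (e 2) v, e 1 v\<rangle>\<^bsub>v\<^esub>) u"
      by (rule pd_cong_open[OF open_U assms(1)]) (auto simp: \<Gamma>_def christoffel_first_induced)
    then show ?thesis
      by (simp add: pd_ip[OF assms(1)] D_e_differentiable x_diff2 assms(1))
  qed
  have "curvature G (x u) (e 1 u) (e 2 u) (e 2 u) = D 1 (D 2 (e 2)) u - D 2 (D 1 (e 2)) u"
    by (rule D_commutator[symmetric]) (auto intro: x_diff2 x_diff3 assms(1) comm)
  then show ?thesis
    unfolding 1 using D_torsion_free[OF assms(1), of 2 1] by (simp add: mform_linear)
qed

end

text \<open>The part of the Gauss equation that depends on the induced metric only, multiplied by its
  determinant.\<close>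

definition gauss_intrinsic :: "(real^2 \<Rightarrow> real^2^2) \<Rightarrow> real^2 \<Rightarrow> real" where
  "gauss_intrinsic g u =
     (let \<Gamma> = (\<lambda>c a b. christoffel_first g c a b u) in
      det (g u) * (pd 1 (christoffel_first g 1 2 2) u - pd 2 (christoffel_first g 1 1 2) u)
      - (g u $ 2 $ 2 * \<Gamma> 1 2 2 * \<Gamma> 1 1 1 - g u $ 1 $ 2 * (\<Gamma> 1 2 2 * \<Gamma> 2 1 1 + \<Gamma> 2 2 2 * \<Gamma> 1 1 1)
         + g u $ 1 $ 1 * \<Gamma> 2 2 2 * \<Gamma> 2 1 1)
      + (g u $ 2 $ 2 * \<Gamma> 1 1 2 * \<Gamma> 1 1 2 - g u $ 1 $ 2 * (\<Gamma> 1 1 2 * \<Gamma> 2 1 2 + \<Gamma> 2 1 2 * \<Gamma> 1 1 2)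
         + g u $ 1 $ 1 * \<Gamma> 2 1 2 * \<Gamma> 2 1 2))"

text \<open>With \<open>p = 0\<close> the range of normal indices is empty and the frame conditions
  are vacuous; the intrinsic copy is such an instance.\<close>

locale framed_patch = patch G V x U for G :: "real^'m::finite \<Rightarrow> real^'m^'m" and V x U +
  fixes p :: nat and n :: "nat \<Rightarrow> real^2 \<Rightarrow> real^'m"
  assumes card_p: "CARD('m) = 2 + p"
    and e_indep: "u \<in> U \<Longrightarrow> s *\<^sub>R pd 1 x u + t *\<^sub>R pd 2 x u = 0 \<Longrightarrow> s = 0 \<and> t = 0"
    and n_diff: "A \<in> {1..p} \<Longrightarrow> u \<in> U \<Longrightarrow> n A differentiable (at u)"
    and n_orthonormal: "A \<in> {1..p} \<Longrightarrow> B \<in> {1..p} \<Longrightarrow> u \<in> U \<Longrightarrow>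
      mform (G (x u)) (n A u) (n B u) = (if A = B then 1 else 0)"
    and n_normal: "A \<in> {1..p} \<Longrightarrow> u \<in> U \<Longrightarrow> mform (G (x u)) (n A u) (pd a x u) = 0"
begin

abbreviation g where "g \<equiv> induced_metric G x"
abbreviation h where "h A u \<equiv> second_ff G x (n A) u"

lemma g_pos:
  assumes "u \<in> U" "X \<noteq> 0"
  shows "mform (g u) X X > 0"
proof -
  have "mform (g u) X X = X $ 1 * X $ 1 * \<langle>e 1 u, e 1 u\<rangle>\<^bsub>u\<^esub> + X $ 1 * X $ 2 * \<langle>e 1 u, e 2 u\<rangle>\<^bsub>u\<^esub>
      + X $ 2 * X $ 1 * \<langle>e 2 u, e 1 u\<rangle>\<^bsub>u\<^esub> + X $ 2 * X $ 2 * \<langle>e 2 u, e 2 u\<rangle>\<^bsub>u\<^esub>"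
    by (rule mform_induced_metric)
  also have "\<dots> = \<langle>X $ 1 *\<^sub>R e 1 u + X $ 2 *\<^sub>R e 2 u, X $ 1 *\<^sub>R e 1 u + X $ 2 *\<^sub>R e 2 u\<rangle>\<^bsub>u\<^esub>"
    by (simp add: mform_add_left mform_add_right mform_scale_left mform_scale_right distrib_left)
  finally have "mform (g u) X X = \<dots>" .
  moreover have "X $ 1 *\<^sub>R e 1 u + X $ 2 *\<^sub>R e 2 u \<noteq> 0"
  proof
    assume "X $ 1 *\<^sub>R e 1 u + X $ 2 *\<^sub>R e 2 u = 0"
    from e_indep[OF assms(1) this] have "X = 0" by (simp only: vec_eq_iff forall_2 zero_index simp_thms)
    with assms(2) show False ..
  qed
  ultimately show ?thesis using G_pos[OF x_in[OF assms(1)]] by simp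
qed

lemma det_g_nz: "u \<in> U \<Longrightarrow> det (g u) \<noteq> 0"
  using invertible_of_posdef[of "g u"] g_pos by (auto simp: invertible_det_nz)

text \<open>The product of a tangent and a normal field vanishes on the open set \<open>U\<close>,
  so its derivative vanishes too. This moves the derivative from the normal to the tangent field,
  where symmetry in \<open>a\<close> and \<open>b\<close> is freedom from torsion.\<close>

lemma h_eq:
  assumes A: "A \<in> {1..p}" and u: "u \<in> U"
  shows "h A u $ a $ b = \<langle>D b (e a) u, n A u\<rangle>\<^bsub>u\<^esub>"
proof -
  have "pd b (\<lambda>v. \<langle>e a v, n A v\<rangle>\<^bsub>v\<^esub>) u = pd b (\<lambda>v. 0) u"
    by (rule pd_cong_open[OF open_U u]) (use A n_normal ip_sym in metis)
  then have "\<langle>D b (e a) u, n A u\<rangle>\<^bsub>u\<^esub> + \<langle>e a u, D b (n A) u\<rangle>\<^bsub>u\<^esub> = 0"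
    using pd_ip[OF u x_diff2[OF u] n_diff[OF A u]] by simp
  then show ?thesis by (simp add: second_ff_def)
qed

lemma h_sym: "A \<in> {1..p} \<Longrightarrow> u \<in> U \<Longrightarrow> h A u $ a $ b = h A u $ b $ a"
  by (metis h_eq D_torsion_free)

lemma ip_expansion:
  assumes u: "u \<in> U"
  shows "det (g u) * \<langle>X, Y\<rangle>\<^bsub>u\<^esub> =
     g u $ 2 $ 2 * \<langle>X, e 1 u\<rangle>\<^bsub>u\<^esub> * \<langle>Y, e 1 u\<rangle>\<^bsub>u\<^esub>
     - g u $ 1 $ 2 * (\<langle>X, e 1 u\<rangle>\<^bsub>u\<^esub> * \<langle>Y, e 2 u\<rangle>\<^bsub>u\<^esub> + \<langle>X, e 2 u\<rangle>\<^bsub>u\<^esub> * \<langle>Y, e 1 u\<rangle>\<^bsub>u\<^esub>)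
     + g u $ 1 $ 1 * \<langle>X, e 2 u\<rangle>\<^bsub>u\<^esub> * \<langle>Y, e 2 u\<rangle>\<^bsub>u\<^esub>
     + det (g u) * (\<Sum>A=1..p. \<langle>X, n A u\<rangle>\<^bsub>u\<^esub> * \<langle>Y, n A u\<rangle>\<^bsub>u\<^esub>)"
proof -
  have det: "det (g u) = \<langle>e 1 u, e 1 u\<rangle>\<^bsub>u\<^esub> * \<langle>e 2 u, e 2 u\<rangle>\<^bsub>u\<^esub> - (\<langle>e 1 u, e 2 u\<rangle>\<^bsub>u\<^esub>)\<^sup>2"
    unfolding det_2 induced_metric_def by (simp add: power2_eq_square ip_sym[OF u, of "e 2 u" "e 1 u"])
  have g: "g u $ a $ b = \<langle>e a u, e b u\<rangle>\<^bsub>u\<^esub>" for a b by (simp add: induced_metric_def)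
  have "(\<langle>e 1 u, e 1 u\<rangle>\<^bsub>u\<^esub> * \<langle>e 2 u, e 2 u\<rangle>\<^bsub>u\<^esub> - (\<langle>e 1 u, e 2 u\<rangle>\<^bsub>u\<^esub>)\<^sup>2) *
      (\<langle>X, Y\<rangle>\<^bsub>u\<^esub> - (\<Sum>A=1..p. \<langle>X, n A u\<rangle>\<^bsub>u\<^esub> * \<langle>Y, n A u\<rangle>\<^bsub>u\<^esub>)) =
     \<langle>e 2 u, e 2 u\<rangle>\<^bsub>u\<^esub> * \<langle>X, e 1 u\<rangle>\<^bsub>u\<^esub> * \<langle>Y, e 1 u\<rangle>\<^bsub>u\<^esub>
     - \<langle>e 1 u, e 2 u\<rangle>\<^bsub>u\<^esub> * (\<langle>X, e 1 u\<rangle>\<^bsub>u\<^esub> * \<langle>Y, e 2 u\<rangle>\<^bsub>u\<^esub> + \<langle>X, e 2 u\<rangle>\<^bsub>u\<^esub> * \<langle>Y, e 1 u\<rangle>\<^bsub>u\<^esub>)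
     + \<langle>e 1 u, e 1 u\<rangle>\<^bsub>u\<^esub> * \<langle>X, e 2 u\<rangle>\<^bsub>u\<^esub> * \<langle>Y, e 2 u\<rangle>\<^bsub>u\<^esub>"
    by (rule adapted_frame_expansion[OF card_p G_sym[OF x_in[OF u]] G_pos[OF x_in[OF u]]
          e_indep[OF u] n_orthonormal[OF _ _ u] n_normal[OF _ u] n_normal[OF _ u]])
  then show ?thesis unfolding det[symmetric] g by (simp add: right_diff_distrib)
qed

lemma gauss_intrinsic_eq:
  assumes u: "u \<in> U"
  shows "gauss_intrinsic g u = det (g u) *
    (\<langle>curvature G (x u) (e 1 u) (e 2 u) (e 2 u), e 1 u\<rangle>\<^bsub>u\<^esub> + (\<Sum>A=1..p. det (h A u)))"
proof -
  have "(\<Sum>A=1..p. det (h A u)) = (\<Sum>A=1..p. \<langle>D 2 (e 2) u, n A u\<rangle>\<^bsub>u\<^esub> * \<langle>D 1 (e 1) u, n A u\<rangle>\<^bsub>u\<^esub>)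
     - (\<Sum>A=1..p. \<langle>D 1 (e 2) u, n A u\<rangle>\<^bsub>u\<^esub> * \<langle>D 1 (e 2) u, n A u\<rangle>\<^bsub>u\<^esub>)"
    unfolding sum_subtractf[symmetric] det_2
    by (rule sum.cong) (auto simp: h_eq u D_torsion_free[OF u, of 2 1])
  then have "det (g u) * (\<Sum>A=1..p. det (h A u)) =
      det (g u) * (\<Sum>A=1..p. \<langle>D 2 (e 2) u, n A u\<rangle>\<^bsub>u\<^esub> * \<langle>D 1 (e 1) u, n A u\<rangle>\<^bsub>u\<^esub>)
     - det (g u) * (\<Sum>A=1..p. \<langle>D 1 (e 2) u, n A u\<rangle>\<^bsub>u\<^esub> * \<langle>D 1 (e 2) u, n A u\<rangle>\<^bsub>u\<^esub>)"
    by (simp add: right_diff_distrib)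
  moreover have "det (g u) * \<langle>curvature G (x u) (e 1 u) (e 2 u) (e 2 u), e 1 u\<rangle>\<^bsub>u\<^esub> =
    det (g u) * (pd 1 (christoffel_first g 1 2 2) u - pd 2 (christoffel_first g 1 1 2) u)
    - det (g u) * \<langle>D 2 (e 2) u, D 1 (e 1) u\<rangle>\<^bsub>u\<^esub> + det (g u) * \<langle>D 1 (e 2) u, D 1 (e 2) u\<rangle>\<^bsub>u\<^esub>"
    unfolding curvature_e[OF u] by (simp add: algebra_simps)
  ultimately show ?thesis
    unfolding gauss_intrinsic_def Let_def christoffel_first_induced[OF u, symmetric]
      ip_expansion[OF u, of "D 2 (e 2) u" "D 1 (e 1) u"] ip_expansion[OF u, of "D 1 (e 2) u" "D 1 (e 2) u"]
    by (simp add: distrib_left)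
qed

text \<open>The previous lemma, applied to the surface with its induced metric and the identity
  parametrisation, is the codimension 0 case; comparing it with the general one gives the
  Gauss equation.\<close>

lemma framed_patch_intrinsic: "framed_patch g U (\<lambda>v. v) U 0 N"
proof
  show "open U" by (rule open_U)
  show "u \<in> U \<Longrightarrow> (s *\<^sub>R pd 1 (\<lambda>v. v) u + t *\<^sub>R pd 2 (\<lambda>v. v) u :: real^2) = 0 \<Longrightarrow> s = 0 \<and> t = 0" for u s t
    by (simp add: vec_eq_iff forall_2 axis_def)
qed (auto intro: induced_metric_sym g_pos induced_metric_differentiable simp: pd_ident[abs_def] pd_const[abs_def])

lemma gauss_equation:
  assumes u: "u \<in> U"
  shows "gaussian_curvature g u =
    (\<langle>curvature G (x u) (e 1 u) (e 2 u) (e 2 u), e 1 u\<rangle>\<^bsub>u\<^esub> + (\<Sum>A=1..p. det (h A u))) / det (g u)"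
proof -
  \<comment> \<open>Any frame serves, as there is no normal index; hence
    \<open>undefined\<close>.\<close>
  interpret I: framed_patch g U "\<lambda>v. v" U 0 undefined by (rule framed_patch_intrinsic)
  have "induced_metric g (\<lambda>v. v) = g"
    by (rule ext) (simp add: induced_metric_def[of g] mform_axis vec_eq_iff)
  with I.gauss_intrinsic_eq[OF u] have "gauss_intrinsic g u = det (g u) *
     mform (g u) (curvature g u (axis 1 1) (axis 2 1) (axis 2 1)) (axis 1 1)" by simp
  \<comment> \<open>Equating the two values of \<open>gauss_intrinsic\<close> cancels one factor
    \<open>det (g u)\<close>; the remaining one is the denominator of the sectional
    curvature.\<close>
  with gauss_intrinsic_eq[OF u] det_g_nz[OF u] show ?thesis
    unfolding gaussian_curvature_def sectional_curvature_def mform_axis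
    by (simp add: det_2[of "g u"] power2_eq_square induced_metric_sym[OF u, of 2 1])
qed

end

section \<open>Traces of the Poisson maps\<close>

lemma Tr_eq: "Tr f = (\<Sum>i\<in>UNIV. f (axis i 1) $ i)"
  by (simp add: Tr_def trace_def matrix_def)

lemma Tr_rank_one: "Tr (\<lambda>X. mform Q w X *\<^sub>R v) = mform Q w v"
proof -
  have "mform Q w v = mform Q w (\<Sum>i\<in>UNIV. v $ i *\<^sub>R axis i 1)"
    using basis_expansion[of v] by (simp add: scalar_mult_eq_scaleR)
  then show ?thesis
    by (simp add: Tr_eq mform_sum_right mform_scale_right mult.commute)
qed

lemma Tr_add: "Tr (\<lambda>X. f X + f' X) = Tr f + Tr f'"
  by (simp add: Tr_eq sum.distrib)

lemma Tr_scale: "Tr (\<lambda>X. t *\<^sub>R f X) = t * Tr f"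
  by (simp add: Tr_eq sum_distrib_left)

lemma lower_map_eps:
  "lower_map Q (\<chi> i j. (1 / r) * (\<Sum>a\<in>UNIV. \<Sum>b\<in>UNIV. eps a b * v a $ i * w b $ j)) X =
    (1 / r) *\<^sub>R (mform Q (w 2) X *\<^sub>R v 1 - mform Q (w 1) X *\<^sub>R v 2)"
  by (simp add: vec_eq_iff lower_map_def mform_def sum_2 eps_def sum_distrib_left sum_distrib_right
      sum_subtractf algebra_simps)

text \<open>The composition is a sum of four rank-one maps, each contributing a product of two
  metric pairings. Leaving \<open>v\<close>, \<open>w\<close>, \<open>v'\<close>, \<open>w'\<close>
  general covers the square of the S-map and the product of the P-map with it.\<close>

lemma Tr_lower_map_eps_comp:
  "Tr (lower_map Q (\<chi> i j. (1 / r) * (\<Sum>a\<in>UNIV. \<Sum>b\<in>UNIV. eps a b * v a $ i * w b $ j)) \<circ>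
       lower_map Q (\<chi> i j. (1 / r) * (\<Sum>a\<in>UNIV. \<Sum>b\<in>UNIV. eps a b * v' a $ i * w' b $ j))) =
    (mform Q (w 2) (v' 1) * mform Q (w' 2) (v 1) - mform Q (w 2) (v' 2) * mform Q (w' 1) (v 1)
     - mform Q (w 1) (v' 1) * mform Q (w' 2) (v 2) + mform Q (w 1) (v' 2) * mform Q (w' 1) (v 2)) / r\<^sup>2"
  (is "Tr ?f = ?t / r\<^sup>2")
proof -
  have f: "?f = (\<lambda>X. (1 / r\<^sup>2) *\<^sub>R
      (mform Q (w 2) (v' 1) *\<^sub>R (mform Q (w' 2) X *\<^sub>R v 1)
       + (- mform Q (w 2) (v' 2)) *\<^sub>R (mform Q (w' 1) X *\<^sub>R v 1)
       + (- mform Q (w 1) (v' 1)) *\<^sub>R (mform Q (w' 2) X *\<^sub>R v 2)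
       + mform Q (w 1) (v' 2) *\<^sub>R (mform Q (w' 1) X *\<^sub>R v 2)))"
    unfolding comp_def lower_map_eps
    by (rule ext) (simp add: mform_linear power2_eq_square algebra_simps)
  show ?thesis unfolding f Tr_scale Tr_add Tr_rank_one by simp
qed

context framed_patch begin

lemma P_map_eq:
  assumes "u \<in> U"
  shows "P_map G r x u =
    lower_map (G (x u)) (\<chi> i j. (1 / r u) * (\<Sum>a\<in>UNIV. \<Sum>b\<in>UNIV. eps a b * e a u $ i * e b u $ j))"
  unfolding P_map_def P_comp_def poisson_def by (simp add: pd_vec_nth x_diff assms)

lemma ip_D_n:
  assumes "u \<in> U"
  shows "\<langle>D b (n A) u, e a u\<rangle>\<^bsub>u\<^esub> = - h A u $ a $ b"
  using ip_sym[OF assms, of "e a u" "D b (n A) u"] by (simp add: second_ff_def)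

text \<open>All pairings are entries of the second fundamental form up to sign. Its symmetry is
  needed: the trace contains the squares of the two off-diagonal entries, the determinant their
  product.\<close>

lemma Tr_S_S:
  assumes A: "A \<in> {1..p}" and u: "u \<in> U"
  shows "Tr (S_map G r x (n A) u \<circ> S_map G r x (n A) u) = - 2 * det (h A u) / (r u)\<^sup>2"
  unfolding S_map_def S_comp_def Tr_lower_map_eps_comp ip_D_n[OF u] det_2 h_sym[OF A u, of 2 1]
  by (simp add: algebra_simps)

text \<open>The trace contracts the adjugate of the induced metric with the second fundamental form,
  and the adjugate is the determinant times the inverse.\<close>

lemma Tr_B:
  assumes u: "u \<in> U"
  shows "Tr (B_map G r x (n A) u) = det (g u) * trace (weingarten G x (n A) u) / (r u)\<^sup>2"
proof -
  have ip: "\<langle>e a u, e b u\<rangle>\<^bsub>u\<^esub> = g u $ a $ b" for a b by (simp add: induced_metric_def)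
  have "Tr (B_map G r x (n A) u) =
      (g u $ 2 $ 2 * h A u $ 1 $ 1 - g u $ 1 $ 2 * h A u $ 2 $ 1
       - g u $ 2 $ 1 * h A u $ 1 $ 2 + g u $ 1 $ 1 * h A u $ 2 $ 2) / (r u)\<^sup>2"
    unfolding B_map_def P_map_eq[OF u] S_map_def S_comp_def Tr_lower_map_eps_comp ip_D_n[OF u] ip
    by simp
  moreover have "trace (weingarten G x (n A) u) =
      (g u $ 2 $ 2 * h A u $ 1 $ 1 - g u $ 1 $ 2 * h A u $ 2 $ 1
       - g u $ 2 $ 1 * h A u $ 1 $ 2 + g u $ 1 $ 1 * h A u $ 2 $ 2) / det (g u)"
    unfolding weingarten_def trace_def matrix_matrix_mult_def
    by (simp add: sum_2 matrix_inv_2 det_g_nz[OF u] add_divide_distrib diff_divide_distrib)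
  ultimately show ?thesis using det_g_nz[OF u] by simp
qed

lemma gauss_curvature_poisson:
  assumes u: "u \<in> U" and "r u \<noteq> 0"
  shows "gaussian_curvature g u =
     1 / det (g u) * \<langle>curvature G (x u) (e 1 u) (e 2 u) (e 2 u), e 1 u\<rangle>\<^bsub>u\<^esub>
     - (r u)\<^sup>2 / (2 * det (g u)) * (\<Sum>A=1..p. Tr (S_map G r x (n A) u \<circ> S_map G r x (n A) u))"
proof -
  have "(\<Sum>A=1..p. Tr (S_map G r x (n A) u \<circ> S_map G r x (n A) u)) = (\<Sum>A=1..p. - 2 / (r u)\<^sup>2 * det (h A u))"
    by (rule sum.cong[OF refl]) (simp add: Tr_S_S u)
  then have "(\<Sum>A=1..p. Tr (S_map G r x (n A) u \<circ> S_map G r x (n A) u)) = - 2 / (r u)\<^sup>2 * (\<Sum>A=1..p. det (h A u))"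
    by (simp only: sum_distrib_left)
  then show ?thesis
    unfolding gauss_equation[OF u] using assms(2) det_g_nz[OF u] by (simp add: field_simps)
qed

lemma mean_curvature_poisson:
  assumes u: "u \<in> U" and "r u \<noteq> 0"
  shows "mean_curvature_vector G x p n u =
     ((r u)\<^sup>2 / (2 * det (g u))) *\<^sub>R (\<Sum>A=1..p. Tr (B_map G r x (n A) u) *\<^sub>R n A u)"
  unfolding mean_curvature_vector_def Tr_B[OF u]
  using assms(2) det_g_nz[OF u] by (simp add: scaleR_sum_right)

end

section \<open>Charts\<close>

lemma smooth_on_differentiable:
  assumes "smooth_on S f" "u \<in> S"
  shows "f differentiable (at u)"
proof -
  have "Ck_on (Suc 0) S f" using assms(1) unfolding smooth_on_def by blast
  then show ?thesis using assms(2) by simp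
qed

lemma smooth_on_pd:
  assumes "smooth_on S f"
  shows "smooth_on S (pd a f)"
  unfolding smooth_on_def
proof
  fix k
  have "Ck_on (Suc k) S f" using assms unfolding smooth_on_def by blast
  then show "Ck_on k S (pd a f)" unfolding pd_def[abs_def] by simp
qed

lemma chart_inv_eq:
  assumes "valid_chart c" "q \<in> fst c"
  shows "chart_inv c (snd c q) = q"
proof -
  obtain f where "homeomorphism (fst c) (snd c ` fst c) (snd c) f"
    using assms(1) unfolding valid_chart_def by blast
  then have "inj_on (snd c) (fst c)" unfolding homeomorphism_def by (metis inj_onI)
  then show ?thesis unfolding chart_inv_def using assms(2) by (rule inv_into_f_f)
qed

text \<open>The homeomorphism gives openness relative to the image of the chart, which is itself
  open.\<close>

lemma open_chart_image:
  assumes "valid_chart c" "open S" "S \<subseteq> fst c"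
  shows "open (snd c ` S)"
proof -
  obtain f where f: "homeomorphism (fst c) (snd c ` fst c) (snd c) f" and o: "open (snd c ` fst c)"
    using assms(1) unfolding valid_chart_def by blast
  have "openin (top_of_set (fst c)) S" using assms(2,3) by (simp add: open_subset)
  from homeomorphism_imp_open_map[OF f this] show ?thesis using o openin_open_eq by blast
qed

lemma riemannian_metric_on:
  assumes "riemannian_manifold M gb" "d \<in> M"
  shows "metric_on (gb d) (snd d ` fst d)"
proof -
  let ?V = "snd d ` fst d"
  have V: "open ?V" and G: "smooth_on ?V (gb d)"
    and sym: "\<And>y. y \<in> ?V \<Longrightarrow> transpose (gb d y) = gb d y"
    and pos: "\<And>y X. y \<in> ?V \<Longrightarrow> X \<noteq> 0 \<Longrightarrow> mform (gb d y) X X > 0"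
    using assms unfolding riemannian_manifold_def smooth_atlas_def valid_chart_def by blast+
  note diff = smooth_on_differentiable[OF G] smooth_on_differentiable[OF smooth_on_pd[OF G]]
  show ?thesis
  proof
    show "gb d y $ i $ j = gb d y $ j $ i" if "y \<in> ?V" for y i j
      using arg_cong[OF sym[OF that], of "\<lambda>A. A $ j $ i"] by (simp add: transpose_def)
    show "(\<lambda>z. gb d z $ i $ j) differentiable (at y)" if "y \<in> ?V" for y i j
      by (intro differentiable_vec_nth diff that)
    show "pd k (\<lambda>z. gb d z $ i $ j) differentiable (at y)" if y: "y \<in> ?V" for k y i j
    proof (rule iffD2[OF differentiable_cong_open[OF V y]])
      show "pd k (\<lambda>z. gb d z $ i $ j) v = pd k (gb d) v $ i $ j" if "v \<in> ?V" for v
        using pd_vec_nth[OF differentiable_vec_nth[OF diff(1)[OF that]], of k i j]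
          pd_vec_nth[OF diff(1)[OF that], of k i] by simp
      show "(\<lambda>v. pd k (gb d) v $ i $ j) differentiable (at y)"
        by (intro differentiable_vec_nth diff y)
    qed
  qed (use V pos in auto)
qed

text \<open>Passage from the manifolds to coordinates. The patch is cut down to where the surface
  chart, the normal frame and the ambient chart are all available.\<close>

lemma framed_patch_of_embedding:
  fixes M :: "('a::{t2_space,second_countable_topology}, 'm::finite) chart set"
    and \<Sigma> :: "('s::{t2_space,second_countable_topology}, 2) chart set"
  assumes M: "riemannian_manifold M gb" and card: "CARD('m) = 2 + p"
    and \<Sigma>: "smooth_atlas \<Sigma>" and F: "smooth_embedding \<Sigma> M F"
    and N: "normal_frame \<Sigma> M gb F W p N" and c: "c \<in> \<Sigma>" and d: "d \<in> M"
  shows "framed_patch (gb d) (snd d ` fst d) (coord_rep F c d)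
    (snd c ` (fst c \<inter> W \<inter> F -` fst d)) p (\<lambda>A. N A d \<circ> chart_inv c)"
proof -
  let ?V = "snd d ` fst d" and ?S = "fst c \<inter> W \<inter> F -` fst d" and ?x = "coord_rep F c d"
  let ?U = "snd c ` ?S"
  interpret metric_on "gb d" ?V using riemannian_metric_on[OF M d] .
  have vc: "valid_chart c" and vd: "valid_chart d"
    using M \<Sigma> c d unfolding riemannian_manifold_def smooth_atlas_def by blast+
  have inv: "chart_inv c (snd c q) = q" if "q \<in> ?S" for q using chart_inv_eq[OF vc] that by blast
  have xq: "?x (snd c q) = snd d (F q)" if "q \<in> ?S" for q by (simp add: coord_rep_def inv[OF that])
  have x: "smooth_on (snd c ` (fst c \<inter> F -` fst d)) ?x"
    and inj: "\<And>q. q \<in> fst c \<inter> F -` fst d \<Longrightarrow> inj (frechet_derivative ?x (at (snd c q)))"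
    using F c d unfolding smooth_embedding_def by blast+
  have U_sub: "v \<in> snd c ` (fst c \<inter> F -` fst d)" if "v \<in> ?U" for v using that by blast
  have open_W: "open W"
    and n: "\<And>A. A \<in> {1..p} \<Longrightarrow> smooth_on ?U (N A d \<circ> chart_inv c)"
    and on: "\<And>A B q. A \<in> {1..p} \<Longrightarrow> B \<in> {1..p} \<Longrightarrow> q \<in> ?S \<Longrightarrow>
      mform (gb d (snd d (F q))) (N A d q) (N B d q) = (if A = B then 1 else 0)"
    and orth: "\<And>A q a. A \<in> {1..p} \<Longrightarrow> q \<in> ?S \<Longrightarrow> mform (gb d (snd d (F q))) (N A d q) (pd a ?x (snd c q)) = 0"
    using N c d unfolding normal_frame_def by blast+
  have "open (fst c)" "open (fst d)" using vc vd by (auto simp: valid_chart_def)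
  \<comment> \<open>\<open>F\<close> is continuous on the carrier only, so the preimage of the
    ambient chart domain is taken inside the open chart domain of the surface.\<close>
  have "continuous_on (carrier \<Sigma>) F"
    using F unfolding smooth_embedding_def homeomorphism_def by blast
  then have "continuous_on (fst c) F" by (rule continuous_on_subset) (use c in \<open>auto simp: carrier_def\<close>)
  then have "open (F -` fst d \<inter> fst c)"
    using continuous_on_open_vimage[OF \<open>open (fst c)\<close>] \<open>open (fst d)\<close> by blast
  then have "open ((F -` fst d \<inter> fst c) \<inter> W)" using open_W by (rule open_Int)
  then have "open ?S" by (simp add: Int_ac)
  show ?thesis
  proof
    show "open ?U" by (rule open_chart_image[OF vc \<open>open ?S\<close>]) blast
    show "?x v \<in> ?V" if "v \<in> ?U" for v using that xq by auto
    show "?x differentiable (at v)" if "v \<in> ?U" for v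
      by (rule smooth_on_differentiable[OF x U_sub[OF that]])
    show "pd a ?x differentiable (at v)" if "v \<in> ?U" for v a
      by (rule smooth_on_differentiable[OF smooth_on_pd[OF x] U_sub[OF that]])
    show "pd b (pd a ?x) differentiable (at v)" if "v \<in> ?U" for v a b
      by (rule smooth_on_differentiable[OF smooth_on_pd[OF smooth_on_pd[OF x]] U_sub[OF that]])
    show "CARD('m) = 2 + p" by (rule card)
    show "s = 0 \<and> t = 0" if v: "v \<in> ?U" and 0: "s *\<^sub>R pd 1 ?x v + t *\<^sub>R pd 2 ?x v = 0" for v s t
    proof -
      let ?D = "frechet_derivative ?x (at v)"
      have lin: "linear ?D"
        by (rule linear_frechet_derivative[OF smooth_on_differentiable[OF x U_sub[OF v]]])
      \<comment> \<open>A relation between the two tangent vectors is a vector in the kernel of the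
        differential, which is injective for an embedding.\<close>
      have "?D (s *\<^sub>R axis 1 1 + t *\<^sub>R axis 2 1) = 0"
        using 0 by (simp add: pd_def linear_add[OF lin] linear_cmul[OF lin])
      moreover have "inj ?D" using v inj by blast
      ultimately have "s *\<^sub>R axis 1 1 + t *\<^sub>R axis 2 1 = (0 :: real^2)"
        using linear_injective_0[OF lin] by blast
      then show ?thesis by (simp add: vec_eq_iff forall_2 axis_def)
    qed
    show "(N A d \<circ> chart_inv c) differentiable (at v)" if "A \<in> {1..p}" "v \<in> ?U" for A v
      by (rule smooth_on_differentiable[OF n[OF that(1)] that(2)])
    show "mform (gb d (?x v)) ((N A d \<circ> chart_inv c) v) ((N B d \<circ> chart_inv c) v) = (if A = B then 1 else 0)"
      if "A \<in> {1..p}" "B \<in> {1..p}" "v \<in> ?U" for A B v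
    proof -
      from that(3) obtain q where q: "q \<in> ?S" "v = snd c q" by blast
      show ?thesis unfolding q(2) o_apply inv[OF q(1)] xq[OF q(1)] by (rule on[OF that(1,2) q(1)])
    qed
    show "mform (gb d (?x v)) ((N A d \<circ> chart_inv c) v) (pd a ?x v) = 0"
      if "A \<in> {1..p}" "v \<in> ?U" for A v a
    proof -
      from that(2) obtain q where q: "q \<in> ?S" "v = snd c q" by blast
      show ?thesis unfolding q(2) o_apply inv[OF q(1)] xq[OF q(1)] by (rule orth[OF that(1) q(1)])
    qed
  qed
qed

theorem theorem3p5:
  fixes M :: "('a::{t2_space,second_countable_topology}, 'm::finite) chart set"
    and gb :: "('a, 'm) chart \<Rightarrow> real^'m \<Rightarrow> real^'m^'m"
    and \<Sigma> :: "('s::{t2_space,second_countable_topology}, 2) chart set"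
    and F :: "'s \<Rightarrow> 'a"
    and \<rho> :: "('s, 2) chart \<Rightarrow> real^2 \<Rightarrow> real"
    and p :: nat
    and W :: "'s set"
    and N :: "nat \<Rightarrow> ('a, 'm) chart \<Rightarrow> 's \<Rightarrow> real^'m"
    and c :: "('s, 2) chart" and d :: "('a, 'm) chart" and s :: 's
    and u :: "real^2" and x :: "real^2 \<Rightarrow> real^'m" and G :: "real^'m \<Rightarrow> real^'m^'m"
    and r :: "real^2 \<Rightarrow> real" and n :: "nat \<Rightarrow> real^2 \<Rightarrow> real^'m" and g :: "real^2 \<Rightarrow> real^2^2"
  assumes "riemannian_manifold M gb" and "CARD('m) = 2 + p"
    and "smooth_atlas \<Sigma>" and "smooth_embedding \<Sigma> M F"
    and "nonvanishing_density \<Sigma> \<rho>"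
    and "normal_frame \<Sigma> M gb F W p N"
    and "c \<in> \<Sigma>" and "d \<in> M" and "s \<in> W" and "s \<in> fst c" and "F s \<in> fst d"
    and "u = snd c s" and "x = coord_rep F c d" and "G = gb d" and "r = \<rho> c"
    and "n = (\<lambda>A. N A d \<circ> chart_inv c)" and "g = induced_metric G x"
  shows "gaussian_curvature g u =
           1 / det (g u) *
             mform (G (x u)) (curvature G (x u) (pd 1 x u) (pd 2 x u) (pd 2 x u)) (pd 1 x u)
           - (r u)\<^sup>2 / (2 * det (g u)) * (\<Sum>A=1..p. Tr (S_map G r x (n A) u \<circ> S_map G r x (n A) u))
       \<and> mean_curvature_vector G x p n u =
           ((r u)\<^sup>2 / (2 * det (g u))) *\<^sub>R (\<Sum>A=1..p. Tr (B_map G r x (n A) u) *\<^sub>R n A u)"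
proof -
  have "framed_patch G (snd d ` fst d) x (snd c ` (fst c \<inter> W \<inter> F -` fst d)) p n"
    unfolding assms(13-16) by (rule framed_patch_of_embedding[OF assms(1-4,6-8)])
  moreover have "u \<in> snd c ` (fst c \<inter> W \<inter> F -` fst d)" using assms(9-12) by simp
  \<comment> \<open>The traces carry the inverse square of the density, which its square in the
    formulas has to cancel.\<close>
  moreover have "r u \<noteq> 0"
    using assms(5,7,10,12,15) unfolding nonvanishing_density_def by blast
  ultimately show ?thesis
    unfolding assms(17)
    by (intro conjI framed_patch.gauss_curvature_poisson framed_patch.mean_curvature_poisson)
qed

end
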